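(* Let $X$ be a compact metric space with metric $d$, let $f\colon X\to X$ be a continuous map with the s-limit shadowing property, let $C\in\mathcal{C}(f)$ and $D\in\mathcal{D}(C)$. Let $\mathcal{F},\mathcal{G}$ be full Furstenberg families which are compatible with $(X^n,f^{\times n})$ for all $n\ge2$, and suppose $\mathcal{F}$ is translation invariant. Let $n\ge2$ and $\delta>0$. If there is an $n$-tuple $(a_1,\dots,a_n)\in[V^s(D)]^n$ with $S_f(a_1,\dots,a_n;\delta)\in\mathcal{F}$, then for every $E\in\mathcal{D}(C)$ and every $0<r<\delta$, $V^s(E)$ is generic $(\mathcal{F},\mathcal{G})$-$n$-$r$-chaotic for $f$.
   Context: A $\delta$-chain of $f$ ($\delta>0$) is a finite sequence $(x_i)_{i=0}^k$, $k\ge1$, with $d(f(x_i),x_{i+1})\le\delta$ for $0\le i\le k-1$; it is a $\delta$-cycle if $x_0=x_k$, with length $k$. Write $x\to y$ if for every $\delta>0$ there is a $\delta$-chain from $x$ to $y$. Let $CR(f)=\{x\colon x\to x\}$; on $CR(f)$ let $x\leftrightarrow y$ iff $x\to y$ and $y\to x$; its classes are the chain components, forming $\mathcal{C}(f)$. For $C\in\mathcal{C}(f)$, $\delta>0$, let $m=m(C,\delta)$ be the gcd of the lengths of all $\delta$-cycles of $f|_C$, and for $x,y\in C$ let $x\sim_{C,\delta}y$ iff there is a $\delta$-chain of $f|_C$ from $x$ to $y$ of length divisible by $m$; $\mathcal{D}(C,\delta)$ is the set of its equivalence classes. Let $x\sim_C y$ iff $x\sim_{C,\delta}y$ for all $\delta>0$;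 $\mathcal{D}(C)$ is its set of classes. For $D\in\mathcal{D}(C)$, $D_\delta$ is the element of $\mathcal{D}(C,\delta)$ containing $D$. $W^s(C)=\{x\colon\lim_i d(f^i(x),C)=0\}$ and $V^s(D)=\bigcap_{\delta>0}\{x\in W^s(C)\colon\lim_i d(f^i(x),f^i(D_\delta))=0\}$. $f$ has the s-limit shadowing property if for every $\epsilon>0$ there is $\delta>0$ such that for every sequence $(x_i)_{i\ge0}$ with $d(f(x_i),x_{i+1})\le\delta$ for all $i$ and $d(f(x_i),x_{i+1})\to0$ there is $x\in X$ with $d(f^i(x),x_i)\le\epsilon$ for all $i$ and $d(f^i(x),x_i)\to0$. A Furstenberg family is a nonempty proper family $\mathcal{F}\subsetneq 2^{\mathbb{N}_0}$ closed under taking supersets; it is full if $\{i\in A\colon i\ge n\}\in\mathcal{F}$ for all $A\in\mathcal{F}$, $n\ge0$; translation invariant if $\{i+n\colon i\in A\}\in\mathcal{F}$ and $\{i\in\mathbb{N}_0\colon i+n\in A\}\in\mathcal{F}$ for all $A\in\mathcal{F}$, $n\ge0$. $f^{\times n}\colon X^n\to X^n$ is the $n$-fold product map. $\mathcal{F}$ is compatible with $(X^n,f^{\times n})$ if for every open $U\subset X^n$ the set $\{z\in X^n\colon\{i\in\mathbb{N}_0\colon (f^{\times n})^i(z)\in U\}\in\mathcal{F}\}$ is a $G_\delta$-subset of $X^n$. For $x_1,\dots,x_n\in X$, $r>0$: $S_f(x_1,\dots,x_n;r)=\{i\in\mathbb{N}_0\colon\min_{j<k}d(f^i(x_j),f^i(x_k))>r\}$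 and $T_f(x_1,\dots,x_n;r)=\{i\in\mathbb{N}_0\colon\max_{j<k}d(f^i(x_j),f^i(x_k))<r\}$. $(x_1,\dots,x_n)$ is $(\mathcal{F},\mathcal{G})$-$r$-scrambled for $f$ if $S_f(x_1,\dots,x_n;r)\in\mathcal{F}$ and $T_f(x_1,\dots,x_n;\epsilon)\in\mathcal{G}$ for all $\epsilon>0$. A nonempty $Y\subset X$ is generic $(\mathcal{F},\mathcal{G})$-$n$-$r$-chaotic for $f$ if the set of $(\mathcal{F},\mathcal{G})$-$r$-scrambled $n$-tuples in $Y^n$ is residual in $Y^n$ (i.e. contains a countable intersection of dense open subsets of $Y^n$ in the subspace topology). *)

theory Defs
  imports "HOL-Analysis.Analysis"
begin

text \<open>A delta-chain of length k (k >= 1) from x to y with all points in S.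
  Chains of f restricted to S are chains all of whose points lie in S.\<close>
definition chain_in :: "('a::metric_space \<Rightarrow> 'a) \<Rightarrow> 'a set \<Rightarrow> real \<Rightarrow> 'a \<Rightarrow> 'a \<Rightarrow> nat \<Rightarrow> bool" where
  "chain_in f S \<delta> x y k \<longleftrightarrow> k \<ge> 1 \<and> (\<exists>xs :: nat \<Rightarrow> 'a. xs 0 = x \<and> xs k = y \<and>
      (\<forall>i\<le>k. xs i \<in> S) \<and> (\<forall>i<k. dist (f (xs i)) (xs (Suc i)) \<le> \<delta>))"

definition chain_rel :: "('a::metric_space \<Rightarrow> 'a) \<Rightarrow> 'a \<Rightarrow> 'a \<Rightarrow> bool" where
  "chain_rel f x y \<longleftrightarrow> (\<forall>\<delta>>0. \<exists>k. chain_in f UNIV \<delta> x y k)"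

definition CR :: "('a::metric_space \<Rightarrow> 'a) \<Rightarrow> 'a set" where
  "CR f = {x. chain_rel f x x}"

definition chain_components :: "('a::metric_space \<Rightarrow> 'a) \<Rightarrow> 'a set set" where
  "chain_components f = {{y \<in> CR f. chain_rel f x y \<and> chain_rel f y x} | x. x \<in> CR f}"

definition cycle_gcd :: "('a::metric_space \<Rightarrow> 'a) \<Rightarrow> 'a set \<Rightarrow> real \<Rightarrow> nat" where
  "cycle_gcd f C \<delta> = Gcd {k. \<exists>x. chain_in f C \<delta> x x k}"

definition sim_delta :: "('a::metric_space \<Rightarrow> 'a) \<Rightarrow> 'a set \<Rightarrow> real \<Rightarrow> 'a \<Rightarrow> 'a \<Rightarrow> bool" where
  "sim_delta f C \<delta> x y \<longleftrightarrow> (\<exists>k. chain_in f C \<delta> x y k \<and> cycle_gcd f C \<delta> dvd k)"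

definition classes_delta :: "('a::metric_space \<Rightarrow> 'a) \<Rightarrow> 'a set \<Rightarrow> real \<Rightarrow> 'a set set" where
  "classes_delta f C \<delta> = {{y \<in> C. sim_delta f C \<delta> x y} | x. x \<in> C}"

definition sim_C :: "('a::metric_space \<Rightarrow> 'a) \<Rightarrow> 'a set \<Rightarrow> 'a \<Rightarrow> 'a \<Rightarrow> bool" where
  "sim_C f C x y \<longleftrightarrow> (\<forall>\<delta>>0. sim_delta f C \<delta> x y)"

definition classes_C :: "('a::metric_space \<Rightarrow> 'a) \<Rightarrow> 'a set \<Rightarrow> 'a set set" where
  "classes_C f C = {{y \<in> C. sim_C f C x y} | x. x \<in> C}"

definition class_of_delta :: "('a::metric_space \<Rightarrow> 'a) \<Rightarrow> 'a set \<Rightarrow> 'a set \<Rightarrow> real \<Rightarrow> 'a set" where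
  "class_of_delta f C D \<delta> = (THE E. E \<in> classes_delta f C \<delta> \<and> D \<subseteq> E)"

definition Ws :: "('a::metric_space \<Rightarrow> 'a) \<Rightarrow> 'a set \<Rightarrow> 'a set" where
  "Ws f C = {x. (\<lambda>i. infdist ((f ^^ i) x) C) \<longlonglongrightarrow> 0}"

definition Vs :: "('a::metric_space \<Rightarrow> 'a) \<Rightarrow> 'a set \<Rightarrow> 'a set \<Rightarrow> 'a set" where
  "Vs f C D = (\<Inter>\<delta>\<in>{0<..}. {x \<in> Ws f C.
      (\<lambda>i. infdist ((f ^^ i) x) ((f ^^ i) ` class_of_delta f C D \<delta>)) \<longlonglongrightarrow> 0})"

definition s_limit_shadowing :: "('a::metric_space \<Rightarrow> 'a) \<Rightarrow> bool" where
  "s_limit_shadowing f \<longleftrightarrow> (\<forall>\<epsilon>>0. \<exists>\<delta>>0. \<forall>xs :: nat \<Rightarrow> 'a.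
      (\<forall>i. dist (f (xs i)) (xs (Suc i)) \<le> \<delta>) \<and> (\<lambda>i. dist (f (xs i)) (xs (Suc i))) \<longlonglongrightarrow> 0 \<longrightarrow>
      (\<exists>x. (\<forall>i. dist ((f ^^ i) x) (xs i) \<le> \<epsilon>) \<and> (\<lambda>i. dist ((f ^^ i) x) (xs i)) \<longlonglongrightarrow> 0))"

definition furstenberg :: "nat set set \<Rightarrow> bool" where
  "furstenberg F \<longleftrightarrow> F \<noteq> {} \<and> F \<noteq> UNIV \<and> (\<forall>A B. A \<in> F \<and> A \<subseteq> B \<longrightarrow> B \<in> F)"

definition full_family :: "nat set set \<Rightarrow> bool" where
  "full_family F \<longleftrightarrow> (\<forall>A\<in>F. \<forall>n. {i \<in> A. i \<ge> n} \<in> F)"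

definition translation_invariant :: "nat set set \<Rightarrow> bool" where
  "translation_invariant F \<longleftrightarrow> (\<forall>A\<in>F. \<forall>n. (\<lambda>i. i + n) ` A \<in> F \<and> {i. i + n \<in> A} \<in> F)"

definition prod_top :: "nat \<Rightarrow> (nat \<Rightarrow> 'a::topological_space) topology" where
  "prod_top n = product_topology (\<lambda>_. euclidean) {..<n}"

definition fprod :: "('a \<Rightarrow> 'a) \<Rightarrow> nat \<Rightarrow> (nat \<Rightarrow> 'a) \<Rightarrow> (nat \<Rightarrow> 'a)" where
  "fprod f n z = (\<lambda>i\<in>{..<n}. f (z i))"

definition compatible :: "nat set set \<Rightarrow> ('a::topological_space \<Rightarrow> 'a) \<Rightarrow> nat \<Rightarrow> bool" where
  "compatible F f n \<longleftrightarrow> (\<forall>U. openin (prod_top n) U \<longrightarrow>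
      gdelta_in (prod_top n) {z \<in> topspace (prod_top n). {i. (fprod f n ^^ i) z \<in> U} \<in> F})"

definition S_set :: "('a::metric_space \<Rightarrow> 'a) \<Rightarrow> nat \<Rightarrow> (nat \<Rightarrow> 'a) \<Rightarrow> real \<Rightarrow> nat set" where
  "S_set f n x r = {i. \<forall>j k. j < k \<and> k < n \<longrightarrow> dist ((f ^^ i) (x j)) ((f ^^ i) (x k)) > r}"

definition T_set :: "('a::metric_space \<Rightarrow> 'a) \<Rightarrow> nat \<Rightarrow> (nat \<Rightarrow> 'a) \<Rightarrow> real \<Rightarrow> nat set" where
  "T_set f n x r = {i. \<forall>j k. j < k \<and> k < n \<longrightarrow> dist ((f ^^ i) (x j)) ((f ^^ i) (x k)) < r}"

definition scrambled :: "nat set set \<Rightarrow> nat set set \<Rightarrow> ('a::metric_space \<Rightarrow> 'a) \<Rightarrow> nat \<Rightarrow> real \<Rightarrow> (nat \<Rightarrow> 'a) \<Rightarrow> bool" where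
  "scrambled F G f n r x \<longleftrightarrow> S_set f n x r \<in> F \<and> (\<forall>\<epsilon>>0. T_set f n x \<epsilon> \<in> G)"

definition residual_in :: "'b topology \<Rightarrow> 'b set \<Rightarrow> bool" where
  "residual_in T S \<longleftrightarrow> (\<exists>U :: nat \<Rightarrow> 'b set. (\<forall>i. openin T (U i) \<and> T closure_of (U i) = topspace T)
      \<and> (\<Inter>i. U i) \<subseteq> S)"

definition generic_chaotic :: "nat set set \<Rightarrow> nat set set \<Rightarrow> ('a::metric_space \<Rightarrow> 'a) \<Rightarrow> nat \<Rightarrow> real \<Rightarrow> 'a set \<Rightarrow> bool" where
  "generic_chaotic F G f n r Y \<longleftrightarrow> Y \<noteq> {} \<and>
     residual_in (subtopology (prod_top n) (PiE {..<n} (\<lambda>_. Y)))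
       {x \<in> PiE {..<n} (\<lambda>_. Y). scrambled F G f n r x}"

end

theory Submission
  imports Defs
begin

text \<open>By compatibility the scrambled tuples form a \<open>G\<^sub>\<delta>\<close> set, so it is enough to find, near every tuple of
  \<open>V\<^sup>s(E)\<close>, one tuple satisfying the proximality condition and one satisfying the separation condition.
  A point of \<open>V\<^sup>s(E)\<close> eventually stays close to the orbit of the class of a base point \<open>e \<in> E\<close>; at a
  fixed scale, two points of one class are joined inside \<open>C\<close> by chains of every large multiple of the
  period. Splicing such a chain into the orbits gives limit pseudo-orbits, and shadowing them moves
  each coordinate onto the forward orbit of any prescribed point of the same class. With target \<open>e\<close> for all
  coordinates the new tuple is proximal. For separation the targets are iterates of \<open>a\<close>, chosen
  so as to lie in the right class at finer and finer scales, and one passes to the limit.\<close>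

section \<open>Chains\<close>

text \<open>At a fixed scale \<open>f\<close> permutes the classes of \<open>C\<close> cyclically,
  so some iterate of \<open>a\<close> follows the class of \<open>e\<close>. The iterate depends on
  the scale, and for an odometer no single one serves all scales; a tuple asymptotic to an iterate
  of \<open>a\<close> therefore need not lie in \<open>Vs f C E\<close>, and separation needs
  infinitely many corrections. Proximality avoids this, because the orbit of \<open>e\<close>
  follows \<open>E\<close> at every scale.

  Membership of the separation times in \<open>F\<close> need not survive limits. Compatibility is
  therefore used twice, for the residual set and for the limit tuple: writing the separated tuples
  as an intersection of open sets \<open>U k\<close> reduces separation of the limit to one open
  condition per stage.

  Splices keep time. The target orbit is entered at its own time \<open>N + L\<close>, and since
  \<open>L\<close> is a multiple of the period, the classes of \<open>(f ^^ N) e\<close> and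
  \<open>(f ^^ (N + L)) e\<close> coincide, so the chain in between joins two points of one
  class.\<close>

lemma chain_in_D:
  assumes "chain_in f S d x y k"
  shows "k \<ge> 1" "x \<in> S" "y \<in> S"
  using assms unfolding chain_in_def by auto

lemma chain_in_trans:
  assumes "chain_in f S d x y k" "chain_in f S d y z l"
  shows "chain_in f S d x z (k + l)"
proof -
  obtain xs where xs: "xs 0 = x" "xs k = y" "\<forall>i\<le>k. xs i \<in> S"
      "\<forall>i<k. dist (f (xs i)) (xs (Suc i)) \<le> d" and k: "k \<ge> 1"
    using assms(1) unfolding chain_in_def by blast
  obtain ys where ys: "ys 0 = y" "ys l = z" "\<forall>i\<le>l. ys i \<in> S"
      "\<forall>i<l. dist (f (ys i)) (ys (Suc i)) \<le> d"
    using assms(2) unfolding chain_in_def by blast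
  define zs where "zs i = (if i \<le> k then xs i else ys (i - k))" for i
  have "zs 0 = x" "zs (k + l) = z" using xs ys by (auto simp: zs_def)
  moreover have "\<forall>i\<le>k+l. zs i \<in> S" using xs ys by (auto simp: zs_def)
  moreover have "dist (f (zs i)) (zs (Suc i)) \<le> d" if "i < k + l" for i
  proof -
    consider "i < k" | "i = k" | "k < i" by linarith
    then show ?thesis
    proof cases
      case 2
      then show ?thesis using xs ys that by (auto simp: zs_def)
    next
      case 3
      then show ?thesis using ys(4)[rule_format, of "i - k"] that by (auto simp: zs_def Suc_diff_le)
    qed (use xs in \<open>auto simp: zs_def\<close>)
  qed
  ultimately show ?thesis using k unfolding chain_in_def by fastforce
qed

lemma chain_in_mono:
  assumes "chain_in f S d x y k" "d \<le> d'" "S \<subseteq> S'"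
  shows "chain_in f S' d' x y k"
proof -
  obtain xs where "k \<ge> 1" "xs 0 = x" "xs k = y" "\<forall>i\<le>k. xs i \<in> S"
      "\<forall>i<k. dist (f (xs i)) (xs (Suc i)) \<le> d"
    using assms(1) unfolding chain_in_def by blast
  with assms(2,3) show ?thesis
    unfolding chain_in_def by (intro conjI exI[of _ xs]) (auto intro: order_trans)
qed

lemma chain_in_orbit:
  assumes "\<And>i. i \<le> k \<Longrightarrow> (f ^^ i) x \<in> S" "k \<ge> 1" "d \<ge> 0"
  shows "chain_in f S d x ((f ^^ k) x) k"
  unfolding chain_in_def using assms by (intro conjI exI[of _ "\<lambda>i. (f ^^ i) x"]) auto

lemma chain_in_move_end:
  assumes "chain_in f S d x y k" "z \<in> S" "dist y z \<le> h"
  shows "chain_in f S (d + h) x z k"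
proof -
  obtain xs where xs: "xs 0 = x" "xs k = y" "\<forall>i\<le>k. xs i \<in> S"
      "\<forall>i<k. dist (f (xs i)) (xs (Suc i)) \<le> d" and k: "k \<ge> 1"
    using assms(1) unfolding chain_in_def by blast
  have h: "0 \<le> h" using assms(3) zero_le_dist order_trans by blast
  have "dist (f ((xs(k := z)) i)) ((xs(k := z)) (Suc i)) \<le> d + h" if "i < k" for i
  proof (cases "Suc i = k")
    case True
    then show ?thesis
      using xs(2,4) that assms(3) dist_triangle[of "f (xs i)" z y] by fastforce
  next
    case False
    then show ?thesis using xs(4) that h by fastforce
  qed
  then show ?thesis
    unfolding chain_in_def using xs k assms(2)
    by (intro conjI exI[of _ "xs(k := z)"]) auto
qed

text \<open>The first point of a chain enters the errors only through its image, so images are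
  compared; callers get the bound from continuity.\<close>

lemma chain_in_move_start:
  assumes "chain_in f S d x y k" "z \<in> S" "dist (f z) (f x) \<le> h"
  shows "chain_in f S (d + h) z y k"
proof -
  obtain xs where xs: "xs 0 = x" "xs k = y" "\<forall>i\<le>k. xs i \<in> S"
      "\<forall>i<k. dist (f (xs i)) (xs (Suc i)) \<le> d" and k: "k \<ge> 1"
    using assms(1) unfolding chain_in_def by blast
  have h: "0 \<le> h" using assms(3) zero_le_dist order_trans by blast
  have "dist (f ((xs(0 := z)) i)) ((xs(0 := z)) (Suc i)) \<le> d + h" if "i < k" for i
  proof (cases "i = 0")
    case True
    then show ?thesis
      using xs(1,4) that assms(3) dist_triangle[of "f z" "xs 1" "f x"] by fastforce
  next
    case False
    then show ?thesis using xs(4) that h by fastforce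
  qed
  then show ?thesis
    unfolding chain_in_def using xs k assms(2)
    by (intro conjI exI[of _ "xs(0 := z)"]) auto
qed

lemma chain_rel_trans:
  assumes "chain_rel f x y" "chain_rel f y z"
  shows "chain_rel f x z"
  using assms chain_in_trans unfolding chain_rel_def by metis

text \<open>Moving \<open>z'\<close> to \<open>z\<close> alters only the last error of one chain and
  the first error of the other. Letting \<open>z'\<close> vary with \<open>d\<close> covers both
  limits of points of \<open>C\<close> and limits of points on ever finer cycles.\<close>

lemma chain_rel_limit:
  assumes cont: "continuous_on UNIV f"
    and near: "\<And>d. d > 0 \<Longrightarrow> \<exists>z' k l. dist z' z < d \<and> chain_in f UNIV d x z' k \<and> chain_in f UNIV d z' x l"
  shows "chain_rel f x z" "chain_rel f z x"
proof -
  have "\<exists>k l. chain_in f UNIV d x z k \<and> chain_in f UNIV d z x l" if "d > 0" for d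
  proof -
    have "d/2 > 0" using that by simp
    then obtain e where e: "e > 0" "\<And>z'. dist z' z < e \<Longrightarrow> dist (f z') (f z) < d/2"
      using cont unfolding continuous_on_iff by blast
    have "min (d/2) e > 0" using e(1) that by simp
    then obtain z' k l where *: "dist z' z < min (d/2) e" "chain_in f UNIV (min (d/2) e) x z' k"
        "chain_in f UNIV (min (d/2) e) z' x l"
      using near by blast
    have "chain_in f UNIV (min (d/2) e + d/2) x z k"
      using chain_in_move_end[OF *(2), of z "d/2"] *(1) by auto
    moreover have "chain_in f UNIV (min (d/2) e + d/2) z x l"
      using chain_in_move_start[OF *(3), of z "d/2"] *(1) e(2)[of z'] by (auto simp: dist_commute)
    moreover have "min (d/2) e + d/2 \<le> d" by auto
    ultimately show ?thesis using chain_in_mono by blast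
  qed
  then show "chain_rel f x z" "chain_rel f z x" unfolding chain_rel_def by blast+
qed

text \<open>A numerical semigroup contains all large multiples of its gcd; it will be applied to the
  cycle lengths at one point. The gcd appears as the least positive difference \<open>g\<close> of
  two elements \<open>a = b + g\<close>, so that trading copies of \<open>b\<close> for copies of
  \<open>a\<close> raises a sum by \<open>g\<close> at a time.\<close>

lemma additive_closed_eventually_multiples:
  fixes S :: "nat set"
  assumes add: "\<And>a b. a \<in> S \<Longrightarrow> b \<in> S \<Longrightarrow> a + b \<in> S" and ne: "S \<noteq> {}" and pos: "0 \<notin> S"
  shows "\<forall>\<^sub>F K in sequentially. K * Gcd S \<in> S"
proof -
  have mult: "Suc q * s \<in> S" if "s \<in> S" for q s
    by (induction q) (use that add in auto)
  have mult': "q * s + t \<in> S" if "s \<in> S" "t \<in> S" for q s t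
    by (cases q) (use that add mult in auto)
  obtain s0 where s0: "s0 \<in> S" using ne by blast
  define P where "P d \<longleftrightarrow> d > 0 \<and> (\<exists>a\<in>S. \<exists>b\<in>S. a = b + d)" for d
  have "P s0" unfolding P_def using s0 add pos by (metis gr0I)
  define g where "g = (LEAST d. P d)"
  have "P g" unfolding g_def using \<open>P s0\<close> by (rule LeastI)
  then obtain a b where ab: "a \<in> S" "b \<in> S" "a = b + g" "g > 0" unfolding P_def by blast
  have g_dvd: "g dvd s" if "s \<in> S" for s
  proof (rule ccontr)
    assume "\<not> g dvd s"
    then have r: "s mod g > 0" by (simp add: mod_greater_zero_iff_not_dvd)
    define q where "q = s div g"
    \<comment> \<open>Trading \<open>q\<close> copies of \<open>b\<close> for \<open>a\<close> gains
      \<open>q * g\<close>, which exhibits the remainder \<open>s mod g\<close> as a difference,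
      against minimality. The summand \<open>s0\<close> keeps \<open>q * a + s0\<close> in
      \<open>S\<close> even for \<open>q = 0\<close>.\<close>
    have "q * b + (s + s0) = (q * a + s0) + s mod g"
      unfolding ab(3) q_def using div_mult_mod_eq[of s g] by (simp add: algebra_simps)
    moreover have "q * b + (s + s0) \<in> S" "q * a + s0 \<in> S" using that s0 ab add mult' by auto
    ultimately have "P (s mod g)" unfolding P_def using r by blast
    then have "g \<le> s mod g" unfolding g_def by (rule Least_le)
    then show False using ab(4) mod_less_divisor[of g s] by linarith
  qed
  have "Gcd S = g"
  proof (rule dvd_antisym)
    have "Gcd S dvd a" "Gcd S dvd b" using ab Gcd_dvd by blast+
    then show "Gcd S dvd g" using ab(3) by (simp add: dvd_add_right_iff)
    show "g dvd Gcd S" using g_dvd Gcd_greatest by blast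
  qed
  obtain b' where b': "b = g * b'" using g_dvd[OF ab(2)] by blast
  have "b' > 0" using b' ab(2) pos by (metis gr0I mult_0_right)
  \<comment> \<open>For \<open>K = c * b' + d\<close>, the multiple \<open>K * g\<close> is
    \<open>d\<close> copies of \<open>a\<close> plus \<open>c - d\<close> copies of
    \<open>b\<close>. The bound \<open>b' * b'\<close> forces the quotient \<open>c\<close> to be at
    least \<open>b'\<close>, hence above the remainder \<open>d\<close>.\<close>
  have "K * g \<in> S" if "K \<ge> b' * b'" for K
  proof -
    define c d where "c = K div b'" and "d = K mod b'"
    have "d < b'" "b' \<le> c"
      unfolding c_def d_def using \<open>b' > 0\<close> that by (auto simp: less_eq_div_iff_mult_less_eq)
    then obtain h where h: "c = d + Suc h" by (metis add_Suc_right less_imp_Suc_add order_less_le_trans)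
    have "K = c * b' + d" unfolding c_def d_def by simp
    then have "K * g = d * a + Suc h * b"
      unfolding h ab(3) b' by (simp add: algebra_simps)
    then show ?thesis using mult' mult ab by auto
  qed
  then show ?thesis unfolding \<open>Gcd S = g\<close> eventually_sequentially by blast
qed

section \<open>Residual sets and Furstenberg families\<close>

lemma residual_in_mono: "residual_in X A \<Longrightarrow> A \<subseteq> B \<Longrightarrow> residual_in X B"
  unfolding residual_in_def by (meson order_trans)

lemma residual_in_INT:
  assumes "\<And>m :: nat. residual_in X (A m)"
  shows "residual_in X (\<Inter>m. A m)"
proof -
  have "\<forall>m. \<exists>U :: nat \<Rightarrow> _. (\<forall>i. openin X (U i) \<and> X closure_of (U i) = topspace X) \<and> (\<Inter>i. U i) \<subseteq> A m"
    using assms unfolding residual_in_def by blast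
  then obtain U where U: "\<And>m i :: nat. openin X (U m i) \<and> X closure_of (U m i) = topspace X"
      "\<And>m. (\<Inter>i. U m i) \<subseteq> A m"
    by metis
  define W where "W k = U (fst (prod_decode k)) (snd (prod_decode k))" for k
  have "(\<Inter>k. W k) \<subseteq> U m i" for m i
  proof -
    have "(\<Inter>k. W k) \<subseteq> W (prod_encode (m, i))" by blast
    then show ?thesis by (simp add: W_def)
  qed
  then have "(\<Inter>k. W k) \<subseteq> (\<Inter>i. U m i)" for m by (intro INT_greatest)
  then have "(\<Inter>k. W k) \<subseteq> (\<Inter>m. A m)" using U(2) by (intro INT_greatest) (rule order_trans)
  moreover have "\<forall>k. openin X (W k) \<and> X closure_of (W k) = topspace X"
    using U(1) by (simp add: W_def)
  ultimately show ?thesis unfolding residual_in_def by blast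
qed

lemma residual_in_Int:
  assumes "residual_in X A" "residual_in X B"
  shows "residual_in X (A \<inter> B)"
proof -
  have "residual_in X (\<Inter>m::nat. if m = 0 then A else B)"
    using assms by (intro residual_in_INT) simp
  moreover have "(\<Inter>m::nat. if m = 0 then A else B) \<subseteq> A \<inter> B" by (auto split: if_splits)
  ultimately show ?thesis by (rule residual_in_mono)
qed

text \<open>Every open superset of \<open>S\<close> inherits its density, so the open sets of a
  G-delta representation, cut with \<open>Y\<close>, are the required dense open sets.\<close>

lemma residual_in_dense_gdelta:
  assumes S: "gdelta_in X S"
    and dense: "\<And>U z. openin X U \<Longrightarrow> z \<in> U \<Longrightarrow> z \<in> Y \<Longrightarrow> \<exists>w. w \<in> U \<and> w \<in> Y \<and> w \<in> S"
  shows "residual_in (subtopology X Y) S"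
proof -
  obtain W :: "nat \<Rightarrow> _" where W: "\<And>k. openin X (W k)" "\<Inter>(range W) = S"
    using S unfolding gdelta_in_descending by blast
  have "subtopology X Y closure_of (W k \<inter> Y) = topspace (subtopology X Y)" for k
    unfolding dense_intersects_open
  proof (intro allI impI)
    fix T assume T: "openin (subtopology X Y) T \<and> T \<noteq> {}"
    then obtain U where U: "openin X U" "T = U \<inter> Y" unfolding openin_subtopology by blast
    then obtain w where "w \<in> U" "w \<in> Y" "w \<in> S" using dense T by blast
    then show "W k \<inter> Y \<inter> T \<noteq> {}" using W(2) U(2) by blast
  qed
  moreover have "openin (subtopology X Y) (W k \<inter> Y)" for k
    using W(1) unfolding openin_subtopology by blast
  ultimately show ?thesis
    unfolding residual_in_def using W(2) by (intro exI[of _ "\<lambda>k. W k \<inter> Y"]) auto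
qed

section \<open>Finite powers of the space and G-delta sets of tuples\<close>

lemma topspace_prod_top: "topspace (prod_top n) = PiE {..<n} (\<lambda>_. UNIV)"
  unfolding prod_top_def by simp

lemma openin_prod_top_contains_box:
  fixes U :: "(nat \<Rightarrow> 'a::metric_space) set"
  assumes "openin (prod_top n) U" "z \<in> U"
  obtains r where "r > 0" "\<And>w. w \<in> topspace (prod_top n) \<Longrightarrow> (\<And>j. j < n \<Longrightarrow> dist (w j) (z j) < r) \<Longrightarrow> w \<in> U"
proof -
  have "\<forall>x\<in>U. \<exists>V. (\<forall>j\<in>{..<n}. open (V j)) \<and> x \<in> PiE {..<n} V \<and> PiE {..<n} V \<subseteq> U"
    using assms(1) unfolding prod_top_def openin_product_topology_alt by simp
  from bspec[OF this assms(2)] obtain V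
    where "\<forall>j\<in>{..<n}. open (V j)" and V': "z \<in> PiE {..<n} V" "PiE {..<n} V \<subseteq> U"
    by blast
  then have V: "open (V j)" if "j < n" for j using that by blast
  have "\<exists>r>0. \<forall>x. dist x (z j) < r \<longrightarrow> x \<in> V j" if "j < n" for j
    using V[OF that] V'(1) that unfolding open_dist by blast
  then obtain r where r: "\<And>j. j < n \<Longrightarrow> r j > 0" "\<And>j x. j < n \<Longrightarrow> dist x (z j) < r j \<Longrightarrow> x \<in> V j"
    by metis
  define R where "R = Min (insert 1 (r ` {..<n}))"
  have "R > 0" unfolding R_def using r(1) by (subst Min_gr_iff) auto
  have R: "R \<le> r j" if "j < n" for j unfolding R_def using that by (intro Min_le) auto
  have "w \<in> U" if w: "w \<in> topspace (prod_top n)" "\<And>j. j < n \<Longrightarrow> dist (w j) (z j) < R" for w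
  proof -
    have "w j \<in> V j" if "j < n" for j using r(2)[OF that] w(2)[OF that] R[OF that] by force
    then have "w \<in> PiE {..<n} V" using w(1) unfolding topspace_prod_top by (auto simp: PiE_iff)
    then show ?thesis using V'(2) by blast
  qed
  with \<open>R > 0\<close> that show ?thesis by blast
qed

text \<open>Separation and proximality both impose an open condition on all pairs of coordinates;
  \<open>Q\<close> stands for either.\<close>

lemma openin_prod_top_pairs:
  fixes Q :: "('a::metric_space \<times> 'a) set"
  assumes "open Q"
  shows "openin (prod_top n) {z \<in> topspace (prod_top n). \<forall>j k. j < k \<and> k < n \<longrightarrow> (z j, z k) \<in> Q}"
proof -
  let ?X = "prod_top n :: (nat \<Rightarrow> 'a) topology"
  define A where "A p = {z \<in> topspace ?X. (z (fst p), z (snd p)) \<in> Q}" for p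
  let ?P = "{p \<in> {..<n} \<times> {..<n}. fst p < snd p}"
  have "openin ?X (A p)" if "p \<in> ?P" for p
  proof -
    have "continuous_map ?X (prod_topology euclidean euclidean) (\<lambda>z. (z (fst p), z (snd p)))"
      unfolding prod_top_def using that
      by (intro continuous_map_pairedI continuous_map_product_projection) auto
    then have "continuous_map ?X euclidean (\<lambda>z. (z (fst p), z (snd p)))"
      by simp
    then have "openin ?X {z \<in> topspace ?X. (z (fst p), z (snd p)) \<in> Q}"
      using assms by (intro openin_continuous_map_preimage) auto
    then show ?thesis unfolding A_def .
  qed
  \<comment> \<open>Inserting the whole space keeps the intersection over a nonempty family when
    \<open>n < 2\<close> leaves no pairs.\<close>
  then have "openin ?X (\<Inter>(insert (topspace ?X) (A ` ?P)))"
    by (intro openin_Inter) auto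
  moreover have "\<Inter>(insert (topspace ?X) (A ` ?P))
      = {z \<in> topspace ?X. \<forall>j k. j < k \<and> k < n \<longrightarrow> (z j, z k) \<in> Q}"
    unfolding A_def by fastforce
  ultimately show ?thesis by simp
qed

lemma fprod_funpow:
  assumes "z \<in> topspace (prod_top n)"
  shows "(fprod f n ^^ i) z = (\<lambda>j\<in>{..<n}. (f ^^ i) (z j))"
proof (induction i)
  case 0
  then show ?case using assms unfolding topspace_prod_top by (auto simp: PiE_iff extensional_restrict)
next
  case (Suc i)
  then show ?case by (auto simp: fprod_def)
qed

lemma compatible_gdelta_pairs:
  fixes f :: "'a::metric_space \<Rightarrow> 'a"
  assumes "compatible F f n" "open Q"
  shows "gdelta_in (prod_top n) {z \<in> topspace (prod_top n).
      {i. \<forall>j k. j < k \<and> k < n \<longrightarrow> ((f ^^ i) (z j), (f ^^ i) (z k)) \<in> Q} \<in> F}"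
proof -
  let ?U = "{z \<in> topspace (prod_top n). \<forall>j k. j < k \<and> k < n \<longrightarrow> (z j, z k) \<in> Q}"
  have eq: "{i. (fprod f n ^^ i) z \<in> ?U} = {i. \<forall>j k. j < k \<and> k < n \<longrightarrow> ((f ^^ i) (z j), (f ^^ i) (z k)) \<in> Q}"
    if "z \<in> topspace (prod_top n)" for z
    unfolding fprod_funpow[OF that] by (fastforce simp: topspace_prod_top)
  have "gdelta_in (prod_top n) {z \<in> topspace (prod_top n). {i. (fprod f n ^^ i) z \<in> ?U} \<in> F}"
    using assms openin_prod_top_pairs unfolding compatible_def by blast
  then show ?thesis by (simp only: eq cong: conj_cong)
qed

lemma gdelta_in_S_set:
  fixes f :: "'a::metric_space \<Rightarrow> 'a"
  assumes "compatible F f n"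
  shows "gdelta_in (prod_top n) {z \<in> topspace (prod_top n). S_set f n z r \<in> F}"
proof -
  have "open {p :: 'a \<times> 'a. r < dist (fst p) (snd p)}"
    by (intro open_Collect_less continuous_intros)
  from compatible_gdelta_pairs[OF assms this] show ?thesis unfolding S_set_def by simp
qed

lemma gdelta_in_T_set:
  fixes f :: "'a::metric_space \<Rightarrow> 'a"
  assumes "compatible F f n"
  shows "gdelta_in (prod_top n) {z \<in> topspace (prod_top n). T_set f n z r \<in> F}"
proof -
  have "open {p :: 'a \<times> 'a. dist (fst p) (snd p) < r}"
    by (intro open_Collect_less continuous_intros)
  from compatible_gdelta_pairs[OF assms this] show ?thesis unfolding T_set_def by simp
qed

lemma continuous_on_funpow:
  fixes f :: "'a::topological_space \<Rightarrow> 'a"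
  assumes "continuous_on UNIV f"
  shows "continuous_on UNIV (f ^^ i)"
proof (induction i)
  case (Suc i)
  then show ?case
    using continuous_on_compose2[OF assms Suc] by (simp add: comp_def)
qed (simp add: id_def)

text \<open>Tuples outside \<open>U\<close> that shadow \<open>v\<close> up to time \<open>N\<close>
  form a decreasing sequence of closed sets \<open>Q N\<close>. Their intersection is empty by
  \<open>sub\<close>, so by compactness some \<open>Q N\<close> is already empty.\<close>

lemma finite_time_shadowing_in_open:
  fixes f :: "'a::metric_space \<Rightarrow> 'a"
  assumes compact: "compact (UNIV :: 'a set)" and cont: "continuous_on UNIV f"
    and U: "openin (prod_top n) U"
    and sub: "\<And>x. x \<in> topspace (prod_top n) \<Longrightarrow> (\<And>i j. j < n \<Longrightarrow> dist ((f ^^ i) (x j)) ((f ^^ i) (v j)) \<le> c) \<Longrightarrow> x \<in> U"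
  obtains N where "\<And>x. x \<in> topspace (prod_top n) \<Longrightarrow>
      (\<And>i j. i < N \<Longrightarrow> j < n \<Longrightarrow> dist ((f ^^ i) (x j)) ((f ^^ i) (v j)) \<le> c) \<Longrightarrow> x \<in> U"
proof -
  let ?X = "prod_top n :: (nat \<Rightarrow> 'a) topology"
  define B where "B N j = {x. \<forall>i<N. dist ((f ^^ i) x) ((f ^^ i) (v j)) \<le> c}" for N j
  define Q where "Q N = PiE {..<n} (B N) - U" for N
  have "compact_space (euclidean :: 'a topology)"
    using compact by (simp add: compact_space_def)
  then have compX: "compact_space ?X"
    unfolding prod_top_def compact_space_product_topology by simp
  have "closed (B N j)" for N j
  proof -
    have "closed (\<Inter>i\<in>{..<N}. {x. dist ((f ^^ i) x) ((f ^^ i) (v j)) \<le> c})"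
      by (intro closed_INT ballI closed_Collect_le continuous_intros continuous_on_funpow cont)
    moreover have "(\<Inter>i\<in>{..<N}. {x. dist ((f ^^ i) x) ((f ^^ i) (v j)) \<le> c}) = B N j"
      unfolding B_def by auto
    ultimately show ?thesis by simp
  qed
  then have "closedin ?X (PiE {..<n} (B N))" for N
    unfolding prod_top_def closedin_product_topology by simp
  then have closed: "closedin ?X (Q N)" for N unfolding Q_def using U by blast
  have "B N' j \<subseteq> B N j" if "N \<le> N'" for N N' j unfolding B_def using that by auto
  then have dec: "decseq Q" unfolding Q_def decseq_def by (meson Diff_mono PiE_mono order_refl)
  have "\<exists>N. Q N = {}"
  proof (rule ccontr)
    assume "\<not> ?thesis"
    then obtain x where x: "x \<in> (\<Inter>N. Q N)"
      using compact_space_imp_nest[OF compX closed _ dec] by blast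
    then have "x \<in> topspace ?X" unfolding Q_def topspace_prod_top by auto
    moreover have "dist ((f ^^ i) (x j)) ((f ^^ i) (v j)) \<le> c" if "j < n" for i j
    proof -
      have "x j \<in> B (Suc i) j" using x that unfolding Q_def by auto
      then show ?thesis unfolding B_def by blast
    qed
    ultimately have "x \<in> U" using sub by blast
    then show False using x unfolding Q_def by blast
  qed
  then obtain N where N: "PiE {..<n} (B N) \<subseteq> U" unfolding Q_def by blast
  have "x \<in> U"
    if "x \<in> topspace ?X" "\<And>i j. i < N \<Longrightarrow> j < n \<Longrightarrow> dist ((f ^^ i) (x j)) ((f ^^ i) (v j)) \<le> c" for x
  proof -
    have "x \<in> PiE {..<n} (B N)"
      using that unfolding B_def topspace_prod_top by (auto simp: PiE_iff)
    then show ?thesis using N by blast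
  qed
  with that show ?thesis by blast
qed

section \<open>Furstenberg families and asymptotic tuples\<close>

lemma furstenberg_mono: "furstenberg F \<Longrightarrow> A \<in> F \<Longrightarrow> A \<subseteq> B \<Longrightarrow> B \<in> F"
  unfolding furstenberg_def by blast

text \<open>Fullness makes membership depend on tails only, which lets asymptotic information enter
  the family.\<close>

lemma furstenberg_full_eventually:
  assumes "furstenberg F" "full_family F" "A \<in> F" "\<forall>\<^sub>F i in sequentially. i \<in> A \<longrightarrow> i \<in> B"
  shows "B \<in> F"
proof -
  obtain N where "\<And>i. i \<ge> N \<Longrightarrow> i \<in> A \<Longrightarrow> i \<in> B"
    using assms(4) unfolding eventually_sequentially by blast
  then have "{i \<in> A. i \<ge> N} \<subseteq> B" by blast
  then show ?thesis using assms(1-3) furstenberg_mono unfolding full_family_def by blast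
qed

lemma S_set_shadow:
  assumes "\<And>i j. j < n \<Longrightarrow> dist ((f ^^ i) (x j)) ((f ^^ i) (v j)) \<le> c"
  shows "S_set f n v (r + 2 * c) \<subseteq> S_set f n x r"
proof
  fix i assume i: "i \<in> S_set f n v (r + 2 * c)"
  have "r < dist ((f ^^ i) (x j)) ((f ^^ i) (x k))" if "j < k" "k < n" for j k
  proof -
    have "dist ((f ^^ i) (v j)) ((f ^^ i) (v k)) > r + 2 * c" using i that unfolding S_set_def by blast
    then show ?thesis
      using assms[of j i] assms[of k i] that
        dist_triangle[of "(f ^^ i) (v j)" "(f ^^ i) (v k)" "(f ^^ i) (x j)"]
        dist_triangle[of "(f ^^ i) (x j)" "(f ^^ i) (v k)" "(f ^^ i) (x k)"]
      by (simp add: dist_commute)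
  qed
  then show "i \<in> S_set f n x r" unfolding S_set_def by blast
qed

text \<open>The separation times of the \<open>t\<close>-th iterate of \<open>a\<close> are those of
  \<open>a\<close> shifted back by \<open>t\<close>, which translation invariance keeps in
  \<open>F\<close>. The gap \<open>\<delta> - r\<close> is split between the two points of a
  pair.\<close>

lemma S_set_asymptotic:
  assumes F: "furstenberg F" "full_family F" "translation_invariant F"
    and a: "S_set f n a \<delta> \<in> F" and "r < \<delta>"
    and asym: "\<And>j. j < n \<Longrightarrow> (\<lambda>i. dist ((f ^^ i) (w j)) ((f ^^ i) ((f ^^ t) (a j)))) \<longlonglongrightarrow> 0"
  shows "S_set f n w r \<in> F"
proof -
  define h where "h = (\<delta> - r) / 2"
  have "h > 0" using \<open>r < \<delta>\<close> by (simp add: h_def)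
  have "{i. i + t \<in> S_set f n a \<delta>} \<in> F" using F(3) a unfolding translation_invariant_def by blast
  moreover have "\<forall>\<^sub>F i in sequentially. \<forall>j\<in>{..<n}. dist ((f ^^ i) (w j)) ((f ^^ i) ((f ^^ t) (a j))) < h"
    using order_tendstoD(2)[OF asym \<open>h > 0\<close>] by (intro eventually_ball_finite) auto
  then have "\<forall>\<^sub>F i in sequentially. i \<in> {i. i + t \<in> S_set f n a \<delta>} \<longrightarrow> i \<in> S_set f n w r"
  proof (rule eventually_mono, intro impI)
    fix i
    assume near: "\<forall>j\<in>{..<n}. dist ((f ^^ i) (w j)) ((f ^^ i) ((f ^^ t) (a j))) < h"
      and i: "i \<in> {i. i + t \<in> S_set f n a \<delta>}"
    have "r < dist ((f ^^ i) (w j)) ((f ^^ i) (w k))" if "j < k" "k < n" for j k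
    proof -
      let ?a = "\<lambda>j. (f ^^ i) ((f ^^ t) (a j))"
      have "dist (?a j) (?a k) > \<delta>" using i that unfolding S_set_def by (auto simp: funpow_add)
      moreover have "dist ((f ^^ i) (w j)) (?a j) < h" "dist ((f ^^ i) (w k)) (?a k) < h"
        using near that by auto
      ultimately show ?thesis
        using dist_triangle[of "?a j" "?a k" "(f ^^ i) (w j)"]
          dist_triangle[of "(f ^^ i) (w j)" "?a k" "(f ^^ i) (w k)"]
        unfolding h_def by (simp add: dist_commute)
    qed
    then show "i \<in> S_set f n w r" unfolding S_set_def by blast
  qed
  ultimately show ?thesis using furstenberg_full_eventually[OF F(1,2)] by blast
qed

text \<open>All coordinates follow one orbit, so every late time is proximal; the family contains
  \<open>UNIV\<close>, and fullness discards the early times.\<close>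

lemma T_set_asymptotic:
  assumes F: "furstenberg F" "full_family F" and "r > 0"
    and asym: "\<And>j. j < n \<Longrightarrow> (\<lambda>i. dist ((f ^^ i) (w j)) ((f ^^ i) e)) \<longlonglongrightarrow> 0"
  shows "T_set f n w r \<in> F"
proof -
  have "r/2 > 0" using \<open>r > 0\<close> by simp
  have "UNIV \<in> F" using F(1) unfolding furstenberg_def by blast
  moreover have "\<forall>\<^sub>F i in sequentially. \<forall>j\<in>{..<n}. dist ((f ^^ i) (w j)) ((f ^^ i) e) < r/2"
    using order_tendstoD(2)[OF asym \<open>r/2 > 0\<close>] by (intro eventually_ball_finite) auto
  then have "\<forall>\<^sub>F i in sequentially. i \<in> UNIV \<longrightarrow> i \<in> T_set f n w r"
  proof (rule eventually_mono, intro impI)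
    fix i
    assume near: "\<forall>j\<in>{..<n}. dist ((f ^^ i) (w j)) ((f ^^ i) e) < r/2"
    have "dist ((f ^^ i) (w j)) ((f ^^ i) (w k)) < r" if "j < k" "k < n" for j k
      using near that dist_triangle_half_l[of "(f ^^ i) (w j)" "(f ^^ i) e" r "(f ^^ i) (w k)"] by auto
    then show "i \<in> T_set f n w r" unfolding T_set_def by blast
  qed
  ultimately show ?thesis using furstenberg_full_eventually[OF F] by blast
qed

section \<open>Chain components and their cyclic structure\<close>

locale chain_component =
  fixes f :: "'a::metric_space \<Rightarrow> 'a" and C :: "'a set"
  assumes compact_UNIV: "compact (UNIV :: 'a set)"
    and continuous: "continuous_on UNIV f"
    and component: "C \<in> chain_components f"
begin

lemma component_eq:
  assumes "x \<in> C"
  shows "C = {y. chain_rel f x y \<and> chain_rel f y x}"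
proof -
  obtain x0 where C: "C = {y \<in> CR f. chain_rel f x0 y \<and> chain_rel f y x0}"
    using component unfolding chain_components_def by blast
  show ?thesis using assms unfolding C CR_def by (auto intro: chain_rel_trans)
qed

lemma component_nonempty: "C \<noteq> {}"
  using component unfolding chain_components_def CR_def by auto

lemma component_chain_rel: "x \<in> C \<Longrightarrow> y \<in> C \<Longrightarrow> chain_rel f x y"
  using component_eq by blast

lemma component_closed_limit:
  assumes "x \<in> C"
    and "\<And>d. d > 0 \<Longrightarrow> \<exists>z' k l. dist z' z < d \<and> chain_in f UNIV d x z' k \<and> chain_in f UNIV d z' x l"
  shows "z \<in> C"
  using chain_rel_limit[OF continuous assms(2)] component_eq[OF assms(1)] by blast

lemma closed_component: "closed C"
proof -
  obtain x where x: "x \<in> C" using component_nonempty by blast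
  have "z \<in> C" if z: "\<forall>e>0. \<exists>y\<in>C. dist y z < e" for z
  proof (rule component_closed_limit[OF x])
    fix d :: real assume "d > 0"
    then obtain y where y: "y \<in> C" "dist y z < d" using z by blast
    obtain k l where "chain_in f UNIV d x y k" "chain_in f UNIV d y x l"
      using component_chain_rel[OF x y(1)] component_chain_rel[OF y(1) x] \<open>d > 0\<close>
      unfolding chain_rel_def by blast
    with y(2) show "\<exists>z' k l. dist z' z < d \<and> chain_in f UNIV d x z' k \<and> chain_in f UNIV d z' x l"
      by blast
  qed
  then have "closure C \<subseteq> C" by (auto simp: closure_approachable)
  then show ?thesis by (simp add: closure_subset_eq)
qed

lemma compact_component: "compact C"
  using compact_Int_closed[OF compact_UNIV closed_component] by simp

lemma f_in_component:
  assumes "x \<in> C"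
  shows "f x \<in> C"
proof -
  have xx: "chain_rel f x x" using component_chain_rel assms by blast
  have "chain_rel f x (f x)"
    unfolding chain_rel_def
  proof (intro allI impI)
    fix d :: real assume "d > 0"
    then show "\<exists>k. chain_in f UNIV d x (f x) k" using chain_in_orbit[of 1 f x UNIV d] by auto
  qed
  moreover have "chain_rel f (f x) x"
    unfolding chain_rel_def
  proof (intro allI impI)
    fix d :: real assume "d > 0"
    then have "d/2 > 0" by simp
    then obtain e where e: "e > 0" "\<And>y. dist y (f x) < e \<Longrightarrow> dist (f y) (f (f x)) < d/2"
      using continuous unfolding continuous_on_iff by blast
    define e' where "e' = min (e/2) (d/2)"
    have "e' > 0" using e \<open>d > 0\<close> by (simp add: e'_def)
    then obtain k where "chain_in f UNIV e' x x k" using xx unfolding chain_rel_def by blast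
    \<comment> \<open>Going round twice leaves a chain of positive length after the first step is
      removed, even for \<open>k = 1\<close>.\<close>
    then have "chain_in f UNIV e' x x (k + k)" "k \<ge> 1" using chain_in_trans chain_in_D by blast+
    then obtain xs where xs: "xs 0 = x" "xs (k + k) = x"
        "\<forall>i<k+k. dist (f (xs i)) (xs (Suc i)) \<le> e'"
      unfolding chain_in_def by blast
    have x1: "dist (f x) (xs 1) \<le> e'" using xs \<open>k \<ge> 1\<close> by fastforce
    have "chain_in f UNIV e' (xs 1) x (k + k - 1)"
      unfolding chain_in_def using xs \<open>k \<ge> 1\<close>
      by (intro conjI exI[of _ "\<lambda>i. xs (Suc i)"]) auto
    moreover have "dist (f (f x)) (f (xs 1)) \<le> d/2"
      using e(2)[of "xs 1"] x1 e(1) by (auto simp: e'_def dist_commute)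
    ultimately have "chain_in f UNIV (e' + d/2) (f x) x (k + k - 1)"
      by (intro chain_in_move_start) auto
    moreover have "e' + d/2 \<le> d" by (simp add: e'_def)
    ultimately show "\<exists>k. chain_in f UNIV d (f x) x k"
      using chain_in_mono by blast
  qed
  ultimately show ?thesis using component_eq[OF assms] by blast
qed

lemma orbit_in_component: "x \<in> C \<Longrightarrow> (f ^^ i) x \<in> C"
  by (induction i) (auto intro: f_in_component)

text \<open>Otherwise points on ever finer cycles through \<open>x\<close>, all at distance at least
  \<open>e\<close> from \<open>C\<close>, would accumulate at a point of \<open>C\<close>.\<close>

lemma short_cycles_near_component:
  assumes x: "x \<in> C" and "e > 0"
  shows "\<exists>d>0. \<forall>z k l. chain_in f UNIV d x z k \<longrightarrow> chain_in f UNIV d z x l \<longrightarrow> (\<exists>c\<in>C. dist z c < e)"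
proof (rule ccontr)
  assume neg: "\<not> ?thesis"
  have "\<exists>z. (\<exists>k l. chain_in f UNIV (1 / Suc j) x z k \<and> chain_in f UNIV (1 / Suc j) z x l)
      \<and> (\<forall>c\<in>C. \<not> dist z c < e)" for j :: nat
  proof -
    have "(1 / Suc j :: real) > 0" by simp
    then show ?thesis using neg by blast
  qed
  then obtain z where z: "\<And>j::nat. \<exists>k l. chain_in f UNIV (1 / Suc j) x (z j) k \<and> chain_in f UNIV (1 / Suc j) (z j) x l"
      "\<And>j c. c \<in> C \<Longrightarrow> \<not> dist (z j) c < e"
    by metis
  obtain p r where r: "strict_mono (r :: nat \<Rightarrow> nat)" and lim: "(z \<circ> r) \<longlonglongrightarrow> p"
    using compact_UNIV unfolding compact_def by blast
  have "p \<in> C"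
  proof (rule component_closed_limit[OF x])
    fix d :: real assume "d > 0"
    obtain j0 where j0: "\<And>j. j \<ge> j0 \<Longrightarrow> dist (z (r j)) p < d"
      using lim \<open>d > 0\<close> unfolding lim_sequentially by auto
    obtain j1 where j1: "1 / Suc j1 < d" using \<open>d > 0\<close> nat_approx_posE by blast
    define j where "j = max j0 j1"
    have "j1 \<le> r j" using seq_suble[OF r, of j] by (simp add: j_def)
    then have "1 / Suc (r j) \<le> 1 / Suc j1" by (simp add: frac_le)
    then have "1 / Suc (r j) \<le> d" using j1 by linarith
    then show "\<exists>z' k l. dist z' p < d \<and> chain_in f UNIV d x z' k \<and> chain_in f UNIV d z' x l"
      using z(1)[of "r j"] j0[of j] chain_in_mono[OF _ _ subset_refl] by (metis j_def max.cobounded1)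
  qed
  moreover obtain j where "dist (z (r j)) p < e"
    using lim \<open>e > 0\<close> unfolding lim_sequentially by auto
  ultimately show False using z(2) by blast
qed

text \<open>Components are defined by chains in the whole space, but periods and classes by chains
  inside \<open>C\<close>; this lemma links the two. A fine chain from \<open>x\<close> to
  \<open>y\<close> closes up through a chain back to \<open>x\<close>, so its points are near
  \<open>C\<close> and can be replaced by points of \<open>C\<close>. Modulus of continuity, chain
  error and displacement take \<open>d/3\<close> each.\<close>

lemma component_chain_transitive:
  assumes x: "x \<in> C" and y: "y \<in> C" and "d > 0"
  shows "\<exists>k. chain_in f C d x y k"
proof -
  have "d/3 > 0" using \<open>d > 0\<close> by simp
  then obtain e0 where e0: "e0 > 0" "\<And>u v. dist u v < e0 \<Longrightarrow> dist (f u) (f v) < d/3"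
    using compact_uniformly_continuous[OF continuous compact_UNIV]
    unfolding uniformly_continuous_on_def by (metis UNIV_I dist_commute)
  define e where "e = min e0 (d/3)"
  have "e > 0" using e0 \<open>d > 0\<close> by (simp add: e_def)
  obtain d0 where d0: "d0 > 0"
     "\<And>z k l. chain_in f UNIV d0 x z k \<Longrightarrow> chain_in f UNIV d0 z x l \<Longrightarrow> \<exists>c\<in>C. dist z c < e"
    using short_cycles_near_component[OF x \<open>e > 0\<close>] by blast
  define d1 where "d1 = min d0 (d/3)"
  have "d1 > 0" using d0 \<open>d > 0\<close> by (simp add: d1_def)
  obtain k where "chain_in f UNIV d1 x y k"
    using component_chain_rel[OF x y] \<open>d1 > 0\<close> unfolding chain_rel_def by blast
  then obtain xs where xs: "xs 0 = x" "xs k = y" "\<forall>i<k. dist (f (xs i)) (xs (Suc i)) \<le> d1" and k: "k \<ge> 1"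
    unfolding chain_in_def by blast
  obtain l where "chain_in f UNIV d1 y x l"
    using component_chain_rel[OF y x] \<open>d1 > 0\<close> unfolding chain_rel_def by blast
  \<comment> \<open>Points already in \<open>C\<close> stay put. This preserves the end points, and
    leaves only interior \<open>i\<close>, where both parts of the chain have positive
    length.\<close>
  have "\<exists>c\<in>C. dist (xs i) c < e \<and> (xs i \<in> C \<longrightarrow> c = xs i)" if "i \<le> k" for i
  proof (cases "xs i \<in> C")
    case True
    then show ?thesis using \<open>e > 0\<close> by (intro bexI[of _ "xs i"]) auto
  next
    case False
    then have "i \<noteq> 0" "i \<noteq> k" using xs(1,2) x y by metis+
    then have i: "0 < i" "i < k" using that by auto
    have "d1 \<le> d0" by (simp add: d1_def)
    have "chain_in f UNIV d1 x (xs i) i"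
      unfolding chain_in_def using xs i by (intro conjI exI[of _ xs]) auto
    then have "chain_in f UNIV d0 x (xs i) i"
      using chain_in_mono \<open>d1 \<le> d0\<close> by blast
    moreover have "chain_in f UNIV d1 (xs i) y (k - i)"
      unfolding chain_in_def using xs i by (intro conjI exI[of _ "\<lambda>j. xs (i + j)"]) auto
    then have "chain_in f UNIV d1 (xs i) x (k - i + l)"
      using chain_in_trans \<open>chain_in f UNIV d1 y x l\<close> by blast
    then have "chain_in f UNIV d0 (xs i) x (k - i + l)"
      using chain_in_mono \<open>d1 \<le> d0\<close> by blast
    ultimately show ?thesis using d0(2) False by blast
  qed
  then obtain c where c: "\<And>i. i \<le> k \<Longrightarrow> c i \<in> C" "\<And>i. i \<le> k \<Longrightarrow> dist (xs i) (c i) < e"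
      "\<And>i. i \<le> k \<Longrightarrow> xs i \<in> C \<Longrightarrow> c i = xs i"
    by metis
  have "dist (f (c i)) (c (Suc i)) \<le> d" if "i < k" for i
  proof -
    have "dist (f (c i)) (f (xs i)) < d/3"
      using e0(2)[of "c i" "xs i"] c(2)[of i] that by (auto simp: e_def dist_commute)
    moreover have "dist (f (xs i)) (xs (Suc i)) \<le> d/3" using xs(3) that by (auto simp: d1_def)
    moreover have "dist (xs (Suc i)) (c (Suc i)) < d/3" using c(2)[of "Suc i"] that by (auto simp: e_def)
    ultimately show ?thesis
      using dist_triangle[of "f (c i)" "c (Suc i)" "f (xs i)"]
        dist_triangle[of "f (xs i)" "c (Suc i)" "xs (Suc i)"] by linarith
  qed
  moreover have "c 0 = x" "c k = y" using c(3)[of 0] c(3)[of k] xs x y by auto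
  ultimately have "chain_in f C d x y k" unfolding chain_in_def using k c(1) by blast
  then show ?thesis by blast
qed

lemma f_image_component: "f ` C = C"
proof
  show "f ` C \<subseteq> C" using f_in_component by blast
  show "C \<subseteq> f ` C"
  proof
    fix y assume y: "y \<in> C"
    have "compact (f ` C)"
      using compact_component continuous continuous_on_subset compact_continuous_image by blast
    then have cl: "closed (f ` C)" by (rule compact_imp_closed)
    have "\<exists>u\<in>f ` C. dist u y < e" if "e > 0" for e
    proof -
      have "e/2 > 0" using that by simp
      then obtain k xs where k: "k \<ge> 1" and xs: "xs k = y" "\<forall>i\<le>k. xs i \<in> C"
          "\<forall>i<k. dist (f (xs i)) (xs (Suc i)) \<le> e/2"
        using component_chain_transitive[OF y y] unfolding chain_in_def by blast
      have "xs (k - 1) \<in> C" "dist (f (xs (k - 1))) y \<le> e/2"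
        using xs(2) xs(3)[rule_format, of "k - 1"] xs(1) k by auto
      then show ?thesis using that by (intro bexI[of _ "f (xs (k - 1))"]) auto
    qed
    then show "y \<in> f ` C" using cl closed_approachable by blast
  qed
qed

lemma funpow_image_component: "(f ^^ i) ` C = C"
proof (induction i)
  case (Suc i)
  then show ?case using f_image_component by (metis funpow_Suc_right image_comp funpow.simps(2))
qed simp

lemma orbit_chain:
  assumes "x \<in> C" "k \<ge> 1" "d \<ge> 0"
  shows "chain_in f C d x ((f ^^ k) x) k"
  using assms orbit_in_component by (intro chain_in_orbit) auto

section \<open>Periods and classes at one scale\<close>

lemma cycle_gcd_dvd: "chain_in f C d x x k \<Longrightarrow> cycle_gcd f C d dvd k"
  unfolding cycle_gcd_def by (rule Gcd_dvd) blast

lemma cycle_gcd_antimono: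
  assumes "d \<le> d'"
  shows "cycle_gcd f C d' dvd cycle_gcd f C d"
proof -
  have "cycle_gcd f C d' dvd k" if "chain_in f C d x x k" for x k
    using that assms cycle_gcd_dvd chain_in_mono by blast
  then show ?thesis unfolding cycle_gcd_def[of f C d] by (intro Gcd_greatest) blast
qed

lemma sim_delta_mono: "sim_delta f C d x y \<Longrightarrow> d \<le> d' \<Longrightarrow> sim_delta f C d' x y"
  unfolding sim_delta_def using chain_in_mono cycle_gcd_antimono dvd_trans by blast

lemma sim_delta_D: "sim_delta f C d x y \<Longrightarrow> x \<in> C \<and> y \<in> C"
  unfolding sim_delta_def using chain_in_D by blast

lemma sim_delta_refl:
  assumes "x \<in> C" "d > 0"
  shows "sim_delta f C d x x"
  using component_chain_transitive[OF assms(1,1,2)] cycle_gcd_dvd unfolding sim_delta_def by blast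

lemma sim_delta_trans:
  assumes "sim_delta f C d x y" "sim_delta f C d y z"
  shows "sim_delta f C d x z"
  using assms chain_in_trans dvd_add unfolding sim_delta_def by metis

text \<open>Only lengths modulo the period matter, and a return chain \<open>q\<close> cancels
  \<open>k\<close> modulo the period because \<open>q + k\<close> is the length of a cycle.\<close>

lemma sim_delta_shift:
  assumes x: "chain_in f C d x x' k" and y: "chain_in f C d y y' k" and "d > 0"
  shows "sim_delta f C d x y \<longleftrightarrow> sim_delta f C d x' y'"
proof
  assume "sim_delta f C d x y"
  then obtain a where a: "chain_in f C d x y a" "cycle_gcd f C d dvd a" unfolding sim_delta_def by blast
  obtain q where q: "chain_in f C d x' x q"
    using component_chain_transitive x chain_in_D \<open>d > 0\<close> by metis
  have "cycle_gcd f C d dvd q + k" using cycle_gcd_dvd chain_in_trans q x by blast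
  then have "cycle_gcd f C d dvd q + a + k" using a(2) by (metis add.assoc add.commute dvd_add)
  then show "sim_delta f C d x' y'"
    unfolding sim_delta_def using chain_in_trans[OF chain_in_trans[OF q a(1)] y] by blast
next
  assume "sim_delta f C d x' y'"
  then obtain a where a: "chain_in f C d x' y' a" "cycle_gcd f C d dvd a" unfolding sim_delta_def by blast
  obtain q where q: "chain_in f C d y' y q"
    using component_chain_transitive y chain_in_D \<open>d > 0\<close> by metis
  have "cycle_gcd f C d dvd q + k" using cycle_gcd_dvd chain_in_trans q y by blast
  then have "cycle_gcd f C d dvd k + a + q" using a(2) by (metis add.assoc add.commute dvd_add)
  then show "sim_delta f C d x y"
    unfolding sim_delta_def using chain_in_trans[OF chain_in_trans[OF x a(1)] q] by blast
qed

lemma sim_delta_sym: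
  assumes "sim_delta f C d x y" "d > 0"
  shows "sim_delta f C d y x"
proof -
  obtain a where a: "chain_in f C d x y a" "cycle_gcd f C d dvd a"
    using assms(1) unfolding sim_delta_def by blast
  obtain q where q: "chain_in f C d y x q"
    using component_chain_transitive a chain_in_D \<open>d > 0\<close> by metis
  have "cycle_gcd f C d dvd a + q" using cycle_gcd_dvd chain_in_trans q a by blast
  then show ?thesis using a(2) q unfolding sim_delta_def by (metis dvd_add_right_iff)
qed

lemma sim_delta_funpow_iff:
  assumes "x \<in> C" "y \<in> C" "d > 0"
  shows "sim_delta f C d ((f ^^ i) x) ((f ^^ i) y) \<longleftrightarrow> sim_delta f C d x y"
proof (cases "i = 0")
  case False
  then show ?thesis
    using sim_delta_shift[OF orbit_chain[of x i d] orbit_chain[of y i d]] assms by auto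
qed simp

lemma sim_delta_funpow_multiple:
  assumes "x \<in> C" "d > 0"
  shows "sim_delta f C d x ((f ^^ (K * cycle_gcd f C d)) x)"
proof (cases "K * cycle_gcd f C d = 0")
  case True
  show ?thesis unfolding True using sim_delta_refl assms by simp
next
  case False
  then show ?thesis unfolding sim_delta_def using orbit_chain[of x "K * cycle_gcd f C d" d] assms
    by (intro exI[of _ "K * cycle_gcd f C d"]) auto
qed

text \<open>Take a cycle at \<open>x\<close> of scale \<open>d/2\<close> and move its end to
  \<open>y\<close>. Its length is a multiple of the period at scale \<open>d/2\<close>, hence of the
  one at scale \<open>d\<close>.\<close>

lemma sim_delta_near:
  assumes "x \<in> C" "y \<in> C" "d > 0" "dist x y \<le> d/2"
  shows "sim_delta f C d x y"
proof -
  obtain k where k: "chain_in f C (d/2) x x k"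
    using component_chain_transitive[of x x "d/2"] assms by auto
  then have "chain_in f C (d/2 + d/2) x y k" using chain_in_move_end assms by blast
  moreover have "cycle_gcd f C d dvd k"
    using dvd_trans[OF cycle_gcd_antimono cycle_gcd_dvd[OF k], of d] assms(3) by simp
  ultimately show ?thesis unfolding sim_delta_def by auto
qed

text \<open>If a chain of length \<open>k\<close> leads from \<open>x\<close> to \<open>y\<close>,
  then \<open>(f ^^ k) x\<close> and \<open>y\<close> are both \<open>k\<close> steps away from
  \<open>x\<close>. Note that \<open>t\<close> depends on \<open>d\<close>.\<close>

lemma some_iterate_sim_delta:
  assumes "x \<in> C" "y \<in> C" "d > 0"
  shows "\<exists>t. sim_delta f C d ((f ^^ t) x) y"
proof -
  obtain k where k: "chain_in f C d x y k" using component_chain_transitive assms by blast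
  have "chain_in f C d x ((f ^^ k) x) k" using orbit_chain chain_in_D(1)[OF k] assms by simp
  then have "sim_delta f C d ((f ^^ k) x) y"
    using sim_delta_shift[OF _ k, of x "(f ^^ k) x"] sim_delta_refl assms by blast
  then show ?thesis by blast
qed

text \<open>Cycle lengths add up only at a common base point, so the period must be read off there.
  A cycle of length \<open>k\<close> elsewhere is inserted into a cycle \<open>p + q\<close> through
  \<open>x\<close>, and the two lengths at \<open>x\<close> differ by \<open>k\<close>.\<close>

lemma Gcd_cycles_at_point:
  assumes x: "x \<in> C" and "d > 0"
  shows "Gcd {k. chain_in f C d x x k} = cycle_gcd f C d"
proof (rule dvd_antisym)
  let ?g = "Gcd {k. chain_in f C d x x k}"
  show "cycle_gcd f C d dvd ?g" using cycle_gcd_dvd by (intro Gcd_greatest) blast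
  have g: "?g dvd k" if "chain_in f C d x x k" for k using that by (intro Gcd_dvd) blast
  have "?g dvd k" if k: "chain_in f C d y y k" for y k
  proof -
    have y: "y \<in> C" using chain_in_D k by blast
    obtain p where p: "chain_in f C d x y p" using component_chain_transitive[OF x y] \<open>d > 0\<close> by blast
    obtain q where q: "chain_in f C d y x q" using component_chain_transitive[OF y x] \<open>d > 0\<close> by blast
    have "?g dvd p + q" "?g dvd p + k + q" using g chain_in_trans p q k by blast+
    then have "?g dvd (p + q) + k" by (simp add: algebra_simps)
    with \<open>?g dvd p + q\<close> show ?thesis by (simp only: dvd_add_right_iff)
  qed
  then show "?g dvd cycle_gcd f C d" unfolding cycle_gcd_def by (intro Gcd_greatest) blast
qed

text \<open>Cycles at \<open>x\<close> realise all large multiples of the period; one fixed chain to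
  \<open>y\<close> is appended.\<close>

lemma sim_delta_eventually_chain:
  assumes "sim_delta f C d x y" and "d > 0"
  shows "\<forall>\<^sub>F K in sequentially. chain_in f C d x y (K * cycle_gcd f C d)"
proof -
  let ?m = "cycle_gcd f C d"
  obtain a where a: "chain_in f C d x y (a * ?m)"
    using assms unfolding sim_delta_def by (metis dvd_def mult.commute)
  have x: "x \<in> C" using a chain_in_D by blast
  have "\<forall>\<^sub>F K in sequentially. K * Gcd {k. chain_in f C d x x k} \<in> {k. chain_in f C d x x k}"
  proof (rule additive_closed_eventually_multiples)
    show "{k. chain_in f C d x x k} \<noteq> {}" using component_chain_transitive[OF x x \<open>d > 0\<close>] by blast
    show "0 \<notin> {k. chain_in f C d x x k}" using chain_in_D(1)[of f C d x x 0] by auto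
  qed (use chain_in_trans in blast)
  then obtain K0 where K0: "\<And>K. K \<ge> K0 \<Longrightarrow> chain_in f C d x x (K * ?m)"
    unfolding Gcd_cycles_at_point[OF x \<open>d > 0\<close>] eventually_sequentially by blast
  have "chain_in f C d x y (K * ?m)" if "K \<ge> K0 + a" for K
  proof -
    have "chain_in f C d x y ((K - a) * ?m + a * ?m)"
      using chain_in_trans[OF K0 a] that by simp
    moreover have "(K - a) * ?m + a * ?m = K * ?m"
      using that by (metis add_mult_distrib le_add_diff_inverse2 le_add2 order_trans)
    ultimately show ?thesis by simp
  qed
  then show ?thesis unfolding eventually_sequentially by blast
qed

text \<open>In a splice the end point of the chain is known only once its length is fixed, so the
  bound on \<open>K\<close> must not depend on \<open>y\<close>. It is obtained for a finite
  \<open>d/2\<close>-net of \<open>C\<close>; the scale \<open>2 * d\<close> pays for moving the end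
  from the net to \<open>y\<close>.\<close>

lemma sim_delta_eventually_chain_uniform:
  assumes "x \<in> C" and "d > 0"
  shows "\<forall>\<^sub>F K in sequentially. \<forall>y. sim_delta f C d x y \<longrightarrow> chain_in f C (2 * d) x y (K * cycle_gcd f C d)"
proof -
  have "d/2 > 0" using \<open>d > 0\<close> by simp
  from seq_compact_imp_totally_bounded[OF compact_imp_seq_compact[OF compact_component], rule_format, OF this]
  obtain P where P: "finite P" "P \<subseteq> C" "C \<subseteq> (\<Union>p\<in>P. ball p (d/2))" by blast
  have "\<forall>\<^sub>F K in sequentially. \<forall>p\<in>{p \<in> P. sim_delta f C d x p}. chain_in f C d x p (K * cycle_gcd f C d)"
    using P(1) sim_delta_eventually_chain \<open>d > 0\<close> by (intro eventually_ball_finite) auto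
  then show ?thesis
  proof (rule eventually_mono, intro allI impI)
    fix K y
    assume K: "\<forall>p\<in>{p \<in> P. sim_delta f C d x p}. chain_in f C d x p (K * cycle_gcd f C d)"
      and xy: "sim_delta f C d x y"
    have y: "y \<in> C" using sim_delta_D xy by blast
    then obtain p where p: "p \<in> P" "dist p y < d/2" using P(3) by auto
    have "sim_delta f C d y p"
      using sim_delta_near[of y p d] y p P(2) \<open>d > 0\<close> by (auto simp: dist_commute)
    then have "sim_delta f C d x p" using sim_delta_trans xy by blast
    then have "chain_in f C d x p (K * cycle_gcd f C d)" using K p(1) by blast
    then have "chain_in f C (d + d) x y (K * cycle_gcd f C d)"
      using p(2) y \<open>d > 0\<close> by (intro chain_in_move_end) auto
    then show "chain_in f C (2 * d) x y (K * cycle_gcd f C d)" by simp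
  qed
qed

subsection \<open>Points attracted to a class\<close>

text \<open>One \<open>d\<close> serves as scale and as distance, and the class of
  \<open>(f ^^ i) e\<close> stands for the \<open>i\<close>-th image of the class of
  \<open>e\<close>. Attraction to a class thus becomes a condition on each time separately.\<close>

definition tracks :: "'a \<Rightarrow> real \<Rightarrow> 'a \<Rightarrow> nat \<Rightarrow> bool" where
  "tracks e d x i \<longleftrightarrow> (\<exists>y. sim_delta f C d ((f ^^ i) e) y \<and> dist ((f ^^ i) x) y < d)"

lemma tracks_mono: "tracks e d x i \<Longrightarrow> d \<le> d' \<Longrightarrow> tracks e d' x i"
  unfolding tracks_def using sim_delta_mono by force

lemma tracks_self: "e \<in> C \<Longrightarrow> d > 0 \<Longrightarrow> tracks e d e i"
  unfolding tracks_def using sim_delta_refl[OF orbit_in_component, of e d i] by force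

lemma tracks_near:
  assumes "tracks e d x i" "dist ((f ^^ i) w) ((f ^^ i) x) \<le> h" "h \<ge> 0"
  shows "tracks e (d + h) w i"
proof -
  obtain y where y: "sim_delta f C d ((f ^^ i) e) y" "dist ((f ^^ i) x) y < d"
    using assms(1) unfolding tracks_def by blast
  have "dist ((f ^^ i) w) y < d + h"
    using y(2) assms(2) dist_triangle[of "(f ^^ i) w" y "(f ^^ i) x"] by linarith
  then show ?thesis unfolding tracks_def using sim_delta_mono[OF y(1), of "d + h"] assms(3) by auto
qed

lemma eventually_tracks_asymptotic:
  assumes "\<forall>\<^sub>F i in sequentially. tracks e d x i"
    and "(\<lambda>i. dist ((f ^^ i) w) ((f ^^ i) x)) \<longlonglongrightarrow> 0" and "h > 0"
  shows "\<forall>\<^sub>F i in sequentially. tracks e (d + h) w i"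
proof -
  have "\<forall>\<^sub>F i in sequentially. dist ((f ^^ i) w) ((f ^^ i) x) < h"
    using order_tendstoD(2)[OF assms(2,3)] .
  with assms(1) show ?thesis
  proof eventually_elim
    case (elim i)
    then show ?case using tracks_near[of e d x i w h] \<open>h > 0\<close> by simp
  qed
qed

text \<open>At time \<open>i\<close>, the point \<open>(f ^^ t) a\<close> is where \<open>a\<close>
  is at time \<open>i + t\<close>, near the class of \<open>(f ^^ (i + t)) c\<close>, which is the
  class of \<open>(f ^^ i) e\<close>. This carries points attracted to \<open>D\<close> over to
  \<open>E\<close>, at one scale.\<close>

lemma eventually_tracks_shift:
  assumes "sim_delta f C d ((f ^^ t) c) e" "c \<in> C" "d > 0"
    and "\<forall>\<^sub>F i in sequentially. tracks c d a i"
  shows "\<forall>\<^sub>F i in sequentially. tracks e d ((f ^^ t) a) i"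
proof -
  obtain N where N: "\<And>i. i \<ge> N \<Longrightarrow> tracks c d a i"
    using assms(4) unfolding eventually_sequentially by blast
  have "tracks e d ((f ^^ t) a) i" if i: "i \<ge> N" for i
  proof -
    obtain y where y: "sim_delta f C d ((f ^^ (i + t)) c) y" "dist ((f ^^ (i + t)) a) y < d"
      using N[OF trans_le_add1[OF i]] unfolding tracks_def by blast
    have "sim_delta f C d ((f ^^ i) ((f ^^ t) c)) ((f ^^ i) e)"
      using sim_delta_funpow_iff assms(1,3) sim_delta_D by blast
    then have "sim_delta f C d ((f ^^ i) e) y"
      using y(1) sim_delta_sym sim_delta_trans \<open>d > 0\<close> by (metis comp_apply funpow_add)
    then show ?thesis using y(2) unfolding tracks_def by (auto simp: funpow_add)
  qed
  then show ?thesis unfolding eventually_sequentially by blast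
qed

lemma classes_C_D:
  assumes "E \<in> classes_C f C"
  shows "E \<subseteq> C" "\<exists>e. e \<in> E"
    and "\<And>x y d. x \<in> E \<Longrightarrow> y \<in> E \<Longrightarrow> d > 0 \<Longrightarrow> sim_delta f C d x y"
proof -
  obtain x where x: "x \<in> C" "E = {y \<in> C. sim_C f C x y}"
    using assms unfolding classes_C_def by blast
  show "E \<subseteq> C" using x by blast
  have "x \<in> E" using x sim_delta_refl unfolding sim_C_def by blast
  then show "\<exists>e. e \<in> E" by blast
  show "sim_delta f C d y z" if "y \<in> E" "z \<in> E" "d > 0" for y z d
    using that sim_delta_sym sim_delta_trans unfolding x(2) sim_C_def by blast
qed

lemma class_of_delta_eq:
  assumes E: "E \<in> classes_C f C" and e: "e \<in> E" and "d > 0"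
  shows "class_of_delta f C E d = {y. sim_delta f C d e y}"
  unfolding class_of_delta_def
proof (rule the_equality)
  have "{y. sim_delta f C d e y} = {y \<in> C. sim_delta f C d e y}" using sim_delta_D by blast
  then show "{y. sim_delta f C d e y} \<in> classes_delta f C d \<and> E \<subseteq> {y. sim_delta f C d e y}"
    using classes_C_D[OF E] e \<open>d > 0\<close> unfolding classes_delta_def by blast
next
  fix E' assume E': "E' \<in> classes_delta f C d \<and> E \<subseteq> E'"
  then obtain x where x: "E' = {y \<in> C. sim_delta f C d x y}" unfolding classes_delta_def by blast
  have "sim_delta f C d x e" using E' e x by blast
  then show "E' = {y. sim_delta f C d e y}"
    unfolding x using sim_delta_sym[OF _ \<open>d > 0\<close>] sim_delta_trans sim_delta_D by blast
qed

text \<open>Since \<open>f\<close> maps \<open>C\<close> onto itself and preserves and reflects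
  \<open>sim_delta\<close>, the \<open>i\<close>-th image of the class of \<open>e\<close> is
  exactly the class of \<open>(f ^^ i) e\<close>.\<close>

lemma Vs_iff_eventually_tracks:
  assumes E: "E \<in> classes_C f C" and e: "e \<in> E"
  shows "x \<in> Vs f C E \<longleftrightarrow> (\<forall>d>0. \<forall>\<^sub>F i in sequentially. tracks e d x i)"
proof (intro iffI allI impI)
  fix d :: real assume x: "x \<in> Vs f C E" and d: "d > 0"
  have eC: "e \<in> C" using classes_C_D(1)[OF E] e by blast
  let ?A = "{y. sim_delta f C d e y}"
  \<comment> \<open>\<open>infdist\<close> to the empty set is 0 by convention, so a small value
    yields a near point only for a nonempty set.\<close>
  have ne: "?A \<noteq> {}" using sim_delta_refl[OF eC d] by blast
  have "(\<lambda>i. infdist ((f ^^ i) x) ((f ^^ i) ` ?A)) \<longlonglongrightarrow> 0"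
    using x d unfolding Vs_def class_of_delta_eq[OF E e d, symmetric] by blast
  then have "\<forall>\<^sub>F i in sequentially. infdist ((f ^^ i) x) ((f ^^ i) ` ?A) < d"
    using d by (rule order_tendstoD(2))
  then show "\<forall>\<^sub>F i in sequentially. tracks e d x i"
  proof eventually_elim
    case (elim i)
    have "\<exists>y\<in>(f ^^ i) ` ?A. dist ((f ^^ i) x) y < d"
    proof (rule ccontr)
      assume "\<not> ?thesis"
      then have "d \<le> infdist ((f ^^ i) x) ((f ^^ i) ` ?A)"
        using ne by (subst infdist_notempty) (auto intro!: cINF_greatest simp: not_less)
      then show False using elim by simp
    qed
    then obtain u where u: "sim_delta f C d e u" "dist ((f ^^ i) x) ((f ^^ i) u) < d" by blast
    then have "sim_delta f C d ((f ^^ i) e) ((f ^^ i) u)"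
      using sim_delta_funpow_iff sim_delta_D d by blast
    then show ?case using u(2) unfolding tracks_def by blast
  qed
next
  assume tr: "\<forall>d>0. \<forall>\<^sub>F i in sequentially. tracks e d x i"
  have eC: "e \<in> C" using classes_C_D(1)[OF E] e by blast
  \<comment> \<open>Used with \<open>A i\<close> constantly \<open>C\<close> for the attraction to
    \<open>C\<close>, and with the images of the class for the attraction to the class.\<close>
  have *: "(\<lambda>i. infdist ((f ^^ i) x) (A i)) \<longlonglongrightarrow> 0"
    if A: "\<And>i y. sim_delta f C d ((f ^^ i) e) y \<Longrightarrow> y \<in> A i" and d: "d > 0" for A d
  proof (rule tendstoI)
    fix r :: real assume "r > 0"
    \<comment> \<open>The scale must not exceed \<open>d\<close>, for the point to lie in the class,
      and the distance must be below \<open>r\<close>.\<close>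
    then have "min d r > 0" using d by simp
    with tr have "\<forall>\<^sub>F i in sequentially. tracks e (min d r) x i" by blast
    then show "\<forall>\<^sub>F i in sequentially. dist (infdist ((f ^^ i) x) (A i)) 0 < r"
    proof eventually_elim
      case (elim i)
      then obtain y where y: "sim_delta f C (min d r) ((f ^^ i) e) y" "dist ((f ^^ i) x) y < min d r"
        unfolding tracks_def by blast
      have "y \<in> A i" using A sim_delta_mono[OF y(1)] by simp
      then have "infdist ((f ^^ i) x) (A i) \<le> dist ((f ^^ i) x) y" by (rule infdist_le)
      then show ?case using y(2) infdist_nonneg[of "(f ^^ i) x" "A i"] by simp
    qed
  qed
  have "(\<lambda>i. infdist ((f ^^ i) x) C) \<longlonglongrightarrow> 0" using *[of 1 "\<lambda>_. C"] sim_delta_D by auto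
  moreover have "(\<lambda>i. infdist ((f ^^ i) x) ((f ^^ i) ` {y. sim_delta f C d e y})) \<longlonglongrightarrow> 0" if d: "d > 0" for d
  proof (rule *[OF _ d])
    fix i y assume y: "sim_delta f C d ((f ^^ i) e) y"
    then have "y \<in> (f ^^ i) ` C" using sim_delta_D funpow_image_component by blast
    then obtain u where u: "u \<in> C" "y = (f ^^ i) u" by blast
    then have "sim_delta f C d e u" using y sim_delta_funpow_iff[OF eC u(1) d] by blast
    then show "y \<in> (f ^^ i) ` {y. sim_delta f C d e y}" using u by blast
  qed
  ultimately show "x \<in> Vs f C E"
    unfolding Vs_def Ws_def using class_of_delta_eq[OF E e] by auto
qed

subsection \<open>Shadowing of spliced orbits\<close>

text \<open>The pseudo-orbit follows \<open>z\<close>, then a chain inside the class, then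
  \<open>b\<close>. Its errors are below \<open>d\<close> on entering the chain, at most
  \<open>2 * d\<close> along it and at most \<open>3 * d\<close> on leaving it; from
  \<open>N + L\<close> on it is a true orbit, so the errors tend to 0.\<close>

lemma shadow_splice:
  assumes shadow: "\<And>xs :: nat \<Rightarrow> 'a. (\<forall>i. dist (f (xs i)) (xs (Suc i)) \<le> 3 * d) \<Longrightarrow>
        (\<lambda>i. dist (f (xs i)) (xs (Suc i))) \<longlonglongrightarrow> 0 \<Longrightarrow>
        \<exists>x. (\<forall>i. dist ((f ^^ i) x) (xs i) \<le> \<epsilon> / 3) \<and> (\<lambda>i. dist ((f ^^ i) x) (xs i)) \<longlonglongrightarrow> 0"
    and d: "d > 0" "3 * d \<le> \<epsilon>" and e: "e \<in> C"
    and y: "sim_delta f C d ((f ^^ N) e) y" "dist ((f ^^ N) z) y < d"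
    and y': "chain_in f C (2 * d) y y' L" "dist ((f ^^ (N + L)) b) y' < d"
    and b: "\<And>i. i \<ge> N \<Longrightarrow> tracks e d b i"
  shows "\<exists>w. (\<forall>i<N. dist ((f ^^ i) w) ((f ^^ i) z) \<le> \<epsilon>) \<and> (\<forall>i\<ge>N. tracks e \<epsilon> w i)
      \<and> (\<lambda>i. dist ((f ^^ i) w) ((f ^^ i) b)) \<longlonglongrightarrow> 0"
proof -
  obtain c where c: "c 0 = y" "c L = y'" "\<forall>i\<le>L. c i \<in> C"
      "\<forall>i<L. dist (f (c i)) (c (Suc i)) \<le> 2 * d" and L: "L \<ge> 1"
    using y'(1) unfolding chain_in_def by blast
  \<comment> \<open>The chain's last point \<open>y'\<close> gives way to
    \<open>(f ^^ (N + L)) b\<close>, so \<open>b\<close> is followed without a time shift.\<close>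
  define xs where "xs i = (if i < N then (f ^^ i) z else if i < N + L then c (i - N) else (f ^^ i) b)" for i
  have err: "dist (f (xs i)) (xs (Suc i)) \<le> 3 * d" for i
  proof -
    consider "Suc i < N" | "Suc i = N" | "N \<le> i" "Suc i < N + L" | "Suc i = N + L" "N \<le> i" | "N + L \<le> i"
      using L by linarith
    then show ?thesis
    proof cases
      case 2
      then have "f (xs i) = (f ^^ N) z" "xs (Suc i) = y" using L c(1) by (auto simp: xs_def)
      then show ?thesis using y(2) d by simp
    next
      case 3
      then have "dist (f (xs i)) (xs (Suc i)) \<le> 2 * d"
        using c(4)[rule_format, of "i - N"] by (auto simp: xs_def Suc_diff_le)
      then show ?thesis using d by simp
    next
      case 4
      define j where "j = i - N"
      have j: "Suc j = L" "j < L" using 4 L by (auto simp: j_def)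
      have "f (xs i) = f (c j)" "xs (Suc i) = (f ^^ (N + L)) b" using 4 L by (auto simp: xs_def j_def)
      moreover have "dist (f (c j)) y' \<le> 2 * d" using c(4)[rule_format, OF j(2)] c(2) j by simp
      ultimately show ?thesis
        using y'(2) dist_triangle[of "f (c j)" "(f ^^ (N + L)) b" y'] by (simp add: dist_commute)
    qed (use d in \<open>auto simp: xs_def\<close>)
  qed
  have "\<forall>\<^sub>F i in sequentially. dist (f (xs i)) (xs (Suc i)) = 0"
    unfolding eventually_sequentially by (intro exI[of _ "N + L"]) (auto simp: xs_def)
  then have "(\<lambda>i. dist (f (xs i)) (xs (Suc i))) \<longlonglongrightarrow> 0" by (rule tendsto_eventually)
  then obtain w where w: "\<And>i. dist ((f ^^ i) w) (xs i) \<le> \<epsilon> / 3" "(\<lambda>i. dist ((f ^^ i) w) (xs i)) \<longlonglongrightarrow> 0"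
    using shadow err by blast
  have "dist ((f ^^ i) w) ((f ^^ i) z) \<le> \<epsilon>" if "i < N" for i
    using w(1)[of i] that d by (simp add: xs_def)
  moreover have "tracks e \<epsilon> w i" if "i \<ge> N" for i
  proof (cases "i < N + L")
    case True
    define j where "j = i - N"
    have j: "i = N + j" "j < L" using True that by (auto simp: j_def)
    have base: "sim_delta f C (2 * d) ((f ^^ N) e) y" using sim_delta_mono[OF y(1)] d by simp
    \<comment> \<open>The chain and the orbit of \<open>(f ^^ N) e\<close> start in one class and
      advance in parallel by \<open>j\<close> steps.\<close>
    have "sim_delta f C (2 * d) ((f ^^ i) e) (c j)"
    proof (cases "j = 0")
      case True
      then show ?thesis using base j c(1) by simp
    next
      case False
      have "chain_in f C (2 * d) ((f ^^ N) e) ((f ^^ j) ((f ^^ N) e)) j"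
        using orbit_chain[OF orbit_in_component[OF e]] False d by simp
      moreover have "chain_in f C (2 * d) y (c j) j"
        unfolding chain_in_def using c j False by (intro conjI exI[of _ c]) auto
      ultimately have "sim_delta f C (2 * d) ((f ^^ j) ((f ^^ N) e)) (c j)"
        using sim_delta_shift base d by fastforce
      then show ?thesis unfolding j(1) by (simp add: funpow_add add.commute[of N j])
    qed
    then have "sim_delta f C \<epsilon> ((f ^^ i) e) (c j)" using sim_delta_mono d by fastforce
    moreover have "dist ((f ^^ i) w) (c j) < \<epsilon>"
      using w(1)[of i] True that d by (simp add: xs_def j_def)
    ultimately show ?thesis unfolding tracks_def by blast
  next
    case False
    then have "dist ((f ^^ i) w) ((f ^^ i) b) \<le> \<epsilon> / 3" using w(1)[of i] by (simp add: xs_def)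
    then have "tracks e (d + \<epsilon> / 3) w i" using tracks_near[OF b[OF that]] d by simp
    then show ?thesis using tracks_mono d by fastforce
  qed
  moreover have "(\<lambda>i. dist ((f ^^ i) w) ((f ^^ i) b)) \<longlonglongrightarrow> 0"
  proof (rule Lim_transform_eventually[OF w(2)])
    show "\<forall>\<^sub>F i in sequentially. dist ((f ^^ i) w) (xs i) = dist ((f ^^ i) w) ((f ^^ i) b)"
      unfolding eventually_sequentially by (intro exI[of _ "N + L"]) (auto simp: xs_def)
  qed
  ultimately show ?thesis by blast
qed

text \<open>The scale \<open>d\<close> comes from shadowing alone, before any tuple is known, so a
  caller can fix all its scales first. The lower bound \<open>N0\<close> lets it demand that the old
  tuple be shadowed for a prescribed time.\<close>

lemma shadow_step:
  assumes "s_limit_shadowing f" and "\<epsilon> > 0" and e: "e \<in> C"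
  shows "\<exists>d>0. \<forall>N0 (z :: nat \<Rightarrow> 'a) b.
      (\<forall>j<n. \<forall>\<^sub>F i in sequentially. tracks e d (z j) i) \<longrightarrow>
      (\<forall>j<n. \<forall>\<^sub>F i in sequentially. tracks e d (b j) i) \<longrightarrow>
      (\<exists>w N. N > N0 \<and> (\<forall>j<n. (\<forall>i<N. dist ((f ^^ i) (w j)) ((f ^^ i) (z j)) \<le> \<epsilon>)
        \<and> (\<forall>i\<ge>N. tracks e \<epsilon> (w j) i) \<and> (\<lambda>i. dist ((f ^^ i) (w j)) ((f ^^ i) (b j))) \<longlonglongrightarrow> 0))"
proof -
  have "\<epsilon> / 3 > 0" using assms by simp
  then obtain d0 where d0: "d0 > 0"
    "\<And>xs :: nat \<Rightarrow> 'a. (\<forall>i. dist (f (xs i)) (xs (Suc i)) \<le> d0) \<and> (\<lambda>i. dist (f (xs i)) (xs (Suc i))) \<longlonglongrightarrow> 0 \<Longrightarrow>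
        \<exists>x. (\<forall>i. dist ((f ^^ i) x) (xs i) \<le> \<epsilon> / 3) \<and> (\<lambda>i. dist ((f ^^ i) x) (xs i)) \<longlonglongrightarrow> 0"
    using assms(1) unfolding s_limit_shadowing_def by blast
  \<comment> \<open>Splicing errors reach \<open>3 * d\<close>, which must not exceed
    \<open>d0\<close>; the bound \<open>3 * d \<le> \<epsilon>\<close> absorbs the class scale
    \<open>2 * d\<close> along the chain and \<open>d + \<epsilon> / 3\<close> after it.\<close>
  define d where "d = min (d0 / 3) (\<epsilon> / 3)"
  have d: "d > 0" "3 * d \<le> \<epsilon>" "3 * d \<le> d0" using d0 assms by (auto simp: d_def)
  have shadow: "\<exists>x. (\<forall>i. dist ((f ^^ i) x) (xs i) \<le> \<epsilon> / 3) \<and> (\<lambda>i. dist ((f ^^ i) x) (xs i)) \<longlonglongrightarrow> 0"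
    if "\<forall>i. dist (f (xs i)) (xs (Suc i)) \<le> 3 * d" "(\<lambda>i. dist (f (xs i)) (xs (Suc i))) \<longlonglongrightarrow> 0"
    for xs :: "nat \<Rightarrow> 'a"
    using d0(2)[of xs] that d(3) by (meson order_trans)
  let ?m = "cycle_gcd f C d"
  show ?thesis
  proof (intro exI[of _ d] conjI allI impI)
    show "d > 0" by (rule d(1))
    fix N0 and z b :: "nat \<Rightarrow> 'a"
    assume z: "\<forall>j<n. \<forall>\<^sub>F i in sequentially. tracks e d (z j) i"
      and b: "\<forall>j<n. \<forall>\<^sub>F i in sequentially. tracks e d (b j) i"
    have "\<forall>\<^sub>F i in sequentially. \<forall>j\<in>{..<n}. tracks e d (z j) i \<and> tracks e d (b j) i"
      using z b by (intro eventually_ball_finite) (auto intro: eventually_conj)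
    then obtain N1 where N1: "\<And>i j. i \<ge> N1 \<Longrightarrow> j < n \<Longrightarrow> tracks e d (z j) i \<and> tracks e d (b j) i"
      unfolding eventually_sequentially by blast
    define N where "N = max N1 (Suc N0)"
    have N: "N \<ge> N1" "N > N0" by (auto simp: N_def)
    have "\<forall>j. \<exists>y. j < n \<longrightarrow> sim_delta f C d ((f ^^ N) e) y \<and> dist ((f ^^ N) (z j)) y < d"
      using N1[OF N(1)] unfolding tracks_def by blast
    then obtain y where y: "\<And>j. j < n \<Longrightarrow> sim_delta f C d ((f ^^ N) e) (y j)"
        "\<And>j. j < n \<Longrightarrow> dist ((f ^^ N) (z j)) (y j) < d"
      by metis
    have "\<forall>\<^sub>F K in sequentially. \<forall>j\<in>{..<n}. \<forall>y'. sim_delta f C d (y j) y' \<longrightarrow> chain_in f C (2 * d) (y j) y' (K * ?m)"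
    proof (intro eventually_ball_finite ballI)
      fix j assume "j \<in> {..<n}"
      then have "y j \<in> C" using y(1) sim_delta_D by blast
      then show "\<forall>\<^sub>F K in sequentially. \<forall>y'. sim_delta f C d (y j) y' \<longrightarrow> chain_in f C (2 * d) (y j) y' (K * ?m)"
        using sim_delta_eventually_chain_uniform d(1) by blast
    qed simp
    then obtain K where K: "\<And>j y'. j < n \<Longrightarrow> sim_delta f C d (y j) y' \<Longrightarrow> chain_in f C (2 * d) (y j) y' (K * ?m)"
      unfolding eventually_sequentially by blast
    \<comment> \<open>The end points \<open>y'\<close> below depend on \<open>L\<close>, which is
      why \<open>K\<close> was chosen for all end points at once.\<close>
    define L where "L = K * ?m"
    have "\<exists>w. (\<forall>i<N. dist ((f ^^ i) w) ((f ^^ i) (z j)) \<le> \<epsilon>) \<and> (\<forall>i\<ge>N. tracks e \<epsilon> w i)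
      \<and> (\<lambda>i. dist ((f ^^ i) w) ((f ^^ i) (b j))) \<longlonglongrightarrow> 0" if j: "j < n" for j
    proof -
      obtain y' where y': "sim_delta f C d ((f ^^ (N + L)) e) y'" "dist ((f ^^ (N + L)) (b j)) y' < d"
        using N1[OF trans_le_add1[OF N(1)] j] unfolding tracks_def by blast
      have "sim_delta f C d ((f ^^ N) e) ((f ^^ L) ((f ^^ N) e))"
        unfolding L_def by (rule sim_delta_funpow_multiple[OF orbit_in_component[OF e] d(1)])
      then have "sim_delta f C d ((f ^^ N) e) ((f ^^ (N + L)) e)"
        by (simp add: funpow_add add.commute[of N L])
      then have "sim_delta f C d (y j) y'"
        using y(1)[OF j] y'(1) sim_delta_trans sim_delta_sym[OF _ d(1)] by blast
      then have chain: "chain_in f C (2 * d) (y j) y' L" unfolding L_def using K j by blast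
      show ?thesis
      proof (rule shadow_splice[OF _ d(1,2) e y(1)[OF j] y(2)[OF j] chain y'(2)])
        fix xs :: "nat \<Rightarrow> 'a"
        assume "\<forall>i. dist (f (xs i)) (xs (Suc i)) \<le> 3 * d" "(\<lambda>i. dist (f (xs i)) (xs (Suc i))) \<longlonglongrightarrow> 0"
        then show "\<exists>x. (\<forall>i. dist ((f ^^ i) x) (xs i) \<le> \<epsilon> / 3) \<and> (\<lambda>i. dist ((f ^^ i) x) (xs i)) \<longlonglongrightarrow> 0"
          by (rule shadow)
      next
        show "tracks e d (b j) i" if "i \<ge> N" for i
          using N1[of i j] that N(1) j by simp
      qed
    qed
    then have "\<forall>j. \<exists>w. j < n \<longrightarrow> (\<forall>i<N. dist ((f ^^ i) w) ((f ^^ i) (z j)) \<le> \<epsilon>)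
        \<and> (\<forall>i\<ge>N. tracks e \<epsilon> w i) \<and> (\<lambda>i. dist ((f ^^ i) w) ((f ^^ i) (b j))) \<longlonglongrightarrow> 0"
      by blast
    then have "\<exists>w. \<forall>j. j < n \<longrightarrow> (\<forall>i<N. dist ((f ^^ i) (w j)) ((f ^^ i) (z j)) \<le> \<epsilon>)
        \<and> (\<forall>i\<ge>N. tracks e \<epsilon> (w j) i) \<and> (\<lambda>i. dist ((f ^^ i) (w j)) ((f ^^ i) (b j))) \<longlonglongrightarrow> 0"
      by (rule choice)
    then show "\<exists>w N. N > N0 \<and> (\<forall>j<n. (\<forall>i<N. dist ((f ^^ i) (w j)) ((f ^^ i) (z j)) \<le> \<epsilon>)
        \<and> (\<forall>i\<ge>N. tracks e \<epsilon> (w j) i) \<and> (\<lambda>i. dist ((f ^^ i) (w j)) ((f ^^ i) (b j))) \<longlonglongrightarrow> 0)"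
      using N(2) by blast
  qed
qed

text \<open>Each correction is small at times before it takes effect, and the sizes sum
  geometrically. At a time between \<open>N (Suc l)\<close> and \<open>N (Suc (Suc l))\<close>, the
  tuple \<open>V (Suc l)\<close> already tracks at scale \<open>\<rho> / 2 ^ Suc l\<close>, and all
  later corrections together cost the same again.\<close>

lemma iterated_shadowing_limit:
  fixes V :: "nat \<Rightarrow> nat \<Rightarrow> 'a" and N :: "nat \<Rightarrow> nat" and \<rho> :: real
  assumes "\<rho> > 0" and N: "strict_mono N"
    and close: "\<And>k i j. i < N (Suc k) \<Longrightarrow> j < n \<Longrightarrow>
        dist ((f ^^ i) (V (Suc k) j)) ((f ^^ i) (V k j)) \<le> \<rho> / 2 ^ Suc k"
    and tracks: "\<And>k i j. i \<ge> N (Suc k) \<Longrightarrow> j < n \<Longrightarrow> tracks e (\<rho> / 2 ^ Suc k) (V (Suc k) j) i"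
  obtains w where "\<And>k i j. i < N (Suc k) \<Longrightarrow> j < n \<Longrightarrow> dist ((f ^^ i) (w j)) ((f ^^ i) (V k j)) \<le> \<rho> / 2 ^ k"
    and "\<And>j d. j < n \<Longrightarrow> d > 0 \<Longrightarrow> \<forall>\<^sub>F i in sequentially. tracks e d (w j) i"
proof -
  have mono: "N k \<le> N l" if "k \<le> l" for k l using strict_mono_leD[OF N that] .
  \<comment> \<open>Subtracting the part of the geometric series not yet spent is what makes the
    induction on \<open>m\<close> close.\<close>
  have tail: "dist ((f ^^ i) (V (k + m) j)) ((f ^^ i) (V k j)) \<le> \<rho> / 2 ^ k - \<rho> / 2 ^ (k + m)"
    if i: "i < N (Suc k)" and j: "j < n" for k m i j
  proof (induction m)
    case (Suc m)
    have "i < N (Suc (k + m))" using i mono[of "Suc k" "Suc (k + m)"] by simp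
    from close[OF this j] have "dist ((f ^^ i) (V (k + Suc m) j)) ((f ^^ i) (V (k + m) j)) \<le> \<rho> / 2 ^ Suc (k + m)"
      by simp
    moreover have "\<rho> / 2 ^ (k + m) = \<rho> / 2 ^ Suc (k + m) + \<rho> / 2 ^ Suc (k + m)" by simp
    ultimately show ?case
      using Suc dist_triangle[of "(f ^^ i) (V (k + Suc m) j)" "(f ^^ i) (V k j)" "(f ^^ i) (V (k + m) j)"]
      by simp
  qed simp
  have "\<exists>x. \<forall>k i. i < N (Suc k) \<longrightarrow> dist ((f ^^ i) x) ((f ^^ i) (V k j)) \<le> \<rho> / 2 ^ k" if j: "j < n" for j
  proof -
    obtain x s where s: "strict_mono (s :: nat \<Rightarrow> nat)" and lim: "(\<lambda>m. V (s m) j) \<longlonglongrightarrow> x"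
      using compact_UNIV[unfolded compact_def, rule_format, of "\<lambda>k. V k j"] by (auto simp: comp_def)
    have "dist ((f ^^ i) x) ((f ^^ i) (V k j)) \<le> \<rho> / 2 ^ k" if i: "i < N (Suc k)" for k i
    proof (rule tendsto_upperbound)
      have "isCont (f ^^ i) x"
        using continuous_on_funpow[OF continuous] by (simp add: continuous_on_eq_continuous_at)
      then have "(\<lambda>m. (f ^^ i) (V (s m) j)) \<longlonglongrightarrow> (f ^^ i) x"
        using lim by (rule isCont_tendsto_compose)
      then show "(\<lambda>m. dist ((f ^^ i) (V (s m) j)) ((f ^^ i) (V k j))) \<longlonglongrightarrow> dist ((f ^^ i) x) ((f ^^ i) (V k j))"
        by (intro tendsto_intros)
      have "dist ((f ^^ i) (V (s m) j)) ((f ^^ i) (V k j)) \<le> \<rho> / 2 ^ k" if "m \<ge> k" for m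
      proof -
        have "k \<le> s m" using seq_suble[OF s, of m] that by simp
        then have "dist ((f ^^ i) (V (s m) j)) ((f ^^ i) (V k j)) \<le> \<rho> / 2 ^ k - \<rho> / 2 ^ s m"
          using tail[OF i j, of "s m - k"] by simp
        moreover have "\<rho> / 2 ^ s m \<ge> 0" using \<open>\<rho> > 0\<close> by simp
        ultimately show ?thesis by linarith
      qed
      then show "\<forall>\<^sub>F m in sequentially. dist ((f ^^ i) (V (s m) j)) ((f ^^ i) (V k j)) \<le> \<rho> / 2 ^ k"
        unfolding eventually_sequentially by blast
    qed simp
    then show ?thesis by blast
  qed
  then obtain w where w: "\<And>j k i. j < n \<Longrightarrow> i < N (Suc k) \<Longrightarrow> dist ((f ^^ i) (w j)) ((f ^^ i) (V k j)) \<le> \<rho> / 2 ^ k"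
    by metis
  have tr: "tracks e (\<rho> / 2 ^ k) (w j) i" if i: "i \<ge> N (Suc k)" and j: "j < n" for k i j
  proof -
    define l where "l = (GREATEST l. N (Suc l) \<le> i)"
    \<comment> \<open>Strict growth of \<open>N\<close> bounds the candidates, so the greatest
      \<open>l\<close> exists and locates the window of times that contains
      \<open>i\<close>.\<close>
    have bound: "l' \<le> i" if "N (Suc l') \<le> i" for l' using seq_suble[OF N, of "Suc l'"] that by simp
    have l: "N (Suc l) \<le> i" unfolding l_def by (rule GreatestI_nat[of _ k]) (use i bound in auto)
    have "k \<le> l" unfolding l_def by (rule Greatest_le_nat) (use i bound in auto)
    have "i < N (Suc (Suc l))"
    proof (rule ccontr)
      assume "\<not> ?thesis"
      then have "Suc l \<le> l" unfolding l_def by (intro Greatest_le_nat[where b = i]) (use bound in \<open>auto simp: l_def\<close>)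
      then show False by simp
    qed
    then have "tracks e (\<rho> / 2 ^ Suc l + \<rho> / 2 ^ Suc l) (w j) i"
      using tracks_near[OF tracks[OF l j] w[OF j]] \<open>\<rho> > 0\<close> by simp
    then have "tracks e (\<rho> / 2 ^ l) (w j) i" by simp
    moreover have "\<rho> / 2 ^ l \<le> \<rho> / 2 ^ k"
      using \<open>k \<le> l\<close> \<open>\<rho> > 0\<close> by (intro divide_left_mono power_increasing) auto
    ultimately show ?thesis using tracks_mono by blast
  qed
  have "\<forall>\<^sub>F i in sequentially. tracks e d (w j) i" if j: "j < n" and d: "d > 0" for j d
  proof -
    obtain k where "(1/2) ^ k < d / \<rho>" using real_arch_pow_inv[of "d / \<rho>" "1/2"] d \<open>\<rho> > 0\<close> by auto
    then have "\<rho> / 2 ^ k \<le> d" using \<open>\<rho> > 0\<close> by (simp add: field_simps)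
    then show ?thesis
      unfolding eventually_sequentially using tr[OF _ j] tracks_mono by blast
  qed
  with w that show ?thesis by blast
qed

text \<open>A limit pseudo-orbit with small errors cannot leave its class at a given scale, so a tuple
  asymptotic to an iterate of \<open>a\<close> lies in the prescribed class only down to that scale.
  The approximating tuples are therefore corrected infinitely often, at scales that have to be fixed in
  advance. Openness of \<open>U k\<close> alone would not survive the later corrections; by
  \<open>finite_time_shadowing_in_open\<close>, shadowing the current tuple for long enough suffices.\<close>

lemma separated_tuple_near:
  fixes U :: "nat \<Rightarrow> (nat \<Rightarrow> 'a) set"
  assumes shadowing: "s_limit_shadowing f"
    and D: "D \<in> classes_C f C" and E: "E \<in> classes_C f C"
    and F: "furstenberg F" "full_family F" "translation_invariant F"
    and a: "\<forall>j<n. a j \<in> Vs f C D" "S_set f n a \<delta> \<in> F"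
    and z: "\<forall>j<n. z j \<in> Vs f C E"
    and U: "\<And>k. openin (prod_top n) (U k)"
    and S_eq: "(\<Inter>k. U k) = {x \<in> topspace (prod_top n). S_set f n x r \<in> F}"
    and \<rho>: "\<rho> > 0" "r + 2 * \<rho> < \<delta>"
  shows "\<exists>w. (\<forall>j<n. w j \<in> Vs f C E \<and> dist (w j) (z j) \<le> 2 * \<rho>)
    \<and> (\<forall>x\<in>topspace (prod_top n). (\<forall>j<n. x j = w j) \<longrightarrow> S_set f n x r \<in> F)"
proof -
  obtain c where c: "c \<in> D" "c \<in> C" using classes_C_D(1,2)[OF D] by blast
  obtain e where e: "e \<in> E" "e \<in> C" using classes_C_D(1,2)[OF E] by blast
  define \<epsilon> where "\<epsilon> k = \<rho> / 2 ^ k" for k :: nat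
  have \<epsilon>: "\<epsilon> k > 0" for k using \<rho> by (simp add: \<epsilon>_def)
  define step where "step k d \<longleftrightarrow> (\<forall>N0 z b.
      (\<forall>j<n. \<forall>\<^sub>F i in sequentially. tracks e d (z j) i) \<longrightarrow>
      (\<forall>j<n. \<forall>\<^sub>F i in sequentially. tracks e d (b j) i) \<longrightarrow>
      (\<exists>w N. N > N0 \<and> (\<forall>j<n. (\<forall>i<N. dist ((f ^^ i) (w j)) ((f ^^ i) (z j)) \<le> \<epsilon> k)
        \<and> (\<forall>i\<ge>N. tracks e (\<epsilon> k) (w j) i) \<and> (\<lambda>i. dist ((f ^^ i) (w j)) ((f ^^ i) (b j))) \<longlonglongrightarrow> 0)))"
    for k d
  have "\<exists>d>0. step k d" for k
  proof -
    from shadow_step[OF shadowing \<epsilon> e(2)] show ?thesis unfolding step_def .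
  qed
  then obtain d where d: "\<And>k. d k > 0" "\<And>k. step k (d k)" by metis
  define good where "good k v \<longleftrightarrow> (\<forall>j<n. \<forall>\<^sub>F i in sequentially. tracks e (d k) (v j) i)" for k v
  have next_tuple: "\<exists>w N. N > N0 \<and> good (Suc k) w \<and> S_set f n w (r + 2 * \<rho>) \<in> F
      \<and> (\<forall>j<n. (\<forall>i<N. dist ((f ^^ i) (w j)) ((f ^^ i) (v j)) \<le> \<epsilon> k) \<and> (\<forall>i\<ge>N. tracks e (\<epsilon> k) (w j) i))"
    if v: "good k v" for k v N0
  proof -
    \<comment> \<open>The target must track at \<open>d k\<close> to be reachable now, and the new
      tuple at \<open>d (Suc k)\<close> to be correctable next; asymptotic closeness costs a further
      \<open>h\<close>, whence the half.\<close>
    define h where "h = min (d k) (d (Suc k) / 2)"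
    have h: "h > 0" "h \<le> d k" "h + h \<le> d (Suc k)" using d(1)[of k] d(1)[of "Suc k"] by (auto simp: h_def)
    obtain t where t: "sim_delta f C h ((f ^^ t) c) e"
      using some_iterate_sim_delta[OF c(2) e(2) h(1)] by blast
    define b where "b j = (f ^^ t) (a j)" for j
    have b: "\<forall>\<^sub>F i in sequentially. tracks e h (b j) i" if "j < n" for j
      unfolding b_def using a(1)[rule_format, OF that] Vs_iff_eventually_tracks[OF D c(1)] h(1)
      by (intro eventually_tracks_shift[OF t c(2) h(1)]) blast
    have "\<forall>\<^sub>F i in sequentially. tracks e (d k) (b j) i" if "j < n" for j
      using b[OF that] by (rule eventually_mono) (use h(2) tracks_mono in blast)
    then have "\<exists>w N. N > N0 \<and> (\<forall>j<n. (\<forall>i<N. dist ((f ^^ i) (w j)) ((f ^^ i) (v j)) \<le> \<epsilon> k)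
        \<and> (\<forall>i\<ge>N. tracks e (\<epsilon> k) (w j) i) \<and> (\<lambda>i. dist ((f ^^ i) (w j)) ((f ^^ i) (b j))) \<longlonglongrightarrow> 0)"
      using d(2)[of k, unfolded step_def, rule_format, of v b N0] v[unfolded good_def] by simp
    then obtain w N where w: "N > N0" "\<forall>j<n. (\<forall>i<N. dist ((f ^^ i) (w j)) ((f ^^ i) (v j)) \<le> \<epsilon> k)
        \<and> (\<forall>i\<ge>N. tracks e (\<epsilon> k) (w j) i) \<and> (\<lambda>i. dist ((f ^^ i) (w j)) ((f ^^ i) (b j))) \<longlonglongrightarrow> 0"
      by (elim exE conjE)
    have "\<forall>\<^sub>F i in sequentially. tracks e (d (Suc k)) (w j) i" if j: "j < n" for j
    proof -
      have "\<forall>\<^sub>F i in sequentially. tracks e (h + h) (w j) i"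
        using eventually_tracks_asymptotic[OF b[OF j] _ h(1)] w(2) j by blast
      then show ?thesis by (rule eventually_mono) (use h(3) tracks_mono in blast)
    qed
    moreover have "S_set f n w (r + 2 * \<rho>) \<in> F"
      using w(2) unfolding b_def by (intro S_set_asymptotic[OF F a(2) \<rho>(2)]) blast
    ultimately show ?thesis using w unfolding good_def by blast
  qed
  \<comment> \<open>The spare \<open>2 * \<rho>\<close> pays for two coordinates moved by
    \<open>\<rho>\<close>: a tuple shadowing \<open>v\<close> within \<open>\<rho>\<close> at all
    times is separated, hence in every \<open>U k\<close>. For each single \<open>k\<close> finitely
    many times suffice.\<close>
  have leave: "\<exists>N. \<forall>x\<in>topspace (prod_top n). (\<forall>i<N. \<forall>j<n. dist ((f ^^ i) (x j)) ((f ^^ i) (v j)) \<le> \<rho>) \<longrightarrow> x \<in> U k"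
    if v: "S_set f n v (r + 2 * \<rho>) \<in> F" for v k
  proof -
    have "x \<in> U k" if "x \<in> topspace (prod_top n)"
      "\<And>i j. j < n \<Longrightarrow> dist ((f ^^ i) (x j)) ((f ^^ i) (v j)) \<le> \<rho>" for x
      using furstenberg_mono[OF F(1) v S_set_shadow[OF that(2)]] that(1) S_eq by blast
    from finite_time_shadowing_in_open[OF compact_UNIV continuous U this] show ?thesis by metis
  qed
  \<comment> \<open>\<open>z\<close> need not be separated, so one correction precedes the
    recursion. It costs \<open>\<epsilon> 0 = \<rho>\<close> and all later ones together at most
    \<open>\<rho>\<close>, whence \<open>2 * \<rho>\<close> in the conclusion.\<close>
  have "good 0 z" unfolding good_def using z Vs_iff_eventually_tracks[OF E e(1)] d(1) by blast
  from next_tuple[OF this, of 0] obtain v0 N0 where v0: "N0 > 0" "good (Suc 0) v0" "S_set f n v0 (r + 2 * \<rho>) \<in> F"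
      "\<forall>j<n. \<forall>i<N0. dist ((f ^^ i) (v0 j)) ((f ^^ i) (z j)) \<le> \<epsilon> 0"
    by blast
  \<comment> \<open>The clause for \<open>k = 0\<close> pins the start to \<open>v0\<close>, whose
    closeness to \<open>z\<close> dependent choice would otherwise forget.\<close>
  define P where "P k s \<longleftrightarrow> good (Suc k) (fst s) \<and> S_set f n (fst s) (r + 2 * \<rho>) \<in> F \<and> (k = 0 \<longrightarrow> fst s = v0)"
    for k and s :: "(nat \<Rightarrow> 'a) \<times> nat"
  define R where "R k s s' \<longleftrightarrow> snd s < snd s'
      \<and> (\<forall>x\<in>topspace (prod_top n). (\<forall>i<snd s'. \<forall>j<n. dist ((f ^^ i) (x j)) ((f ^^ i) (fst s j)) \<le> \<rho>) \<longrightarrow> x \<in> U k)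
      \<and> (\<forall>j<n. (\<forall>i<snd s'. dist ((f ^^ i) (fst s' j)) ((f ^^ i) (fst s j)) \<le> \<epsilon> (Suc k))
          \<and> (\<forall>i\<ge>snd s'. tracks e (\<epsilon> (Suc k)) (fst s' j) i))"
    for k and s s' :: "(nat \<Rightarrow> 'a) \<times> nat"
  have "\<exists>st. \<forall>k. P k (st k) \<and> R k (st k) (st (Suc k))"
  proof (rule dependent_nat_choice)
    show "\<exists>s. P 0 s" unfolding P_def using v0 by auto
    fix s k assume s: "P k s"
    obtain M where M: "\<forall>x\<in>topspace (prod_top n). (\<forall>i<M. \<forall>j<n. dist ((f ^^ i) (x j)) ((f ^^ i) (fst s j)) \<le> \<rho>) \<longrightarrow> x \<in> U k"
      using leave s unfolding P_def by blast
    \<comment> \<open>Shadowing beyond \<open>M\<close> secures \<open>U k\<close> for the limit;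
      passing \<open>snd s\<close> keeps the times strictly increasing.\<close>
    obtain w N where w: "N > max M (snd s)" "good (Suc (Suc k)) w" "S_set f n w (r + 2 * \<rho>) \<in> F"
      "\<forall>j<n. (\<forall>i<N. dist ((f ^^ i) (w j)) ((f ^^ i) (fst s j)) \<le> \<epsilon> (Suc k)) \<and> (\<forall>i\<ge>N. tracks e (\<epsilon> (Suc k)) (w j) i)"
      using next_tuple[of "Suc k" "fst s" "max M (snd s)"] s unfolding P_def by blast
    have "\<forall>x\<in>topspace (prod_top n). (\<forall>i<N. \<forall>j<n. dist ((f ^^ i) (x j)) ((f ^^ i) (fst s j)) \<le> \<rho>) \<longrightarrow> x \<in> U k"
      using M w(1) by (meson less_trans max.strict_boundedE)
    then have "P (Suc k) (w, N) \<and> R k s (w, N)" unfolding P_def R_def using w by simp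
    then show "\<exists>s'. P (Suc k) s' \<and> R k s s'" by blast
  qed
  then obtain st where P: "\<And>k. P k (st k)" and R: "\<And>k. R k (st k) (st (Suc k))" by blast
  define V N where "V k = fst (st k)" and "N k = snd (st k)" for k
  have N: "strict_mono N" using R unfolding R_def N_def strict_mono_Suc_iff by blast
  obtain w where w: "\<And>k i j. i < N (Suc k) \<Longrightarrow> j < n \<Longrightarrow> dist ((f ^^ i) (w j)) ((f ^^ i) (V k j)) \<le> \<rho> / 2 ^ k"
      "\<And>j d. j < n \<Longrightarrow> d > 0 \<Longrightarrow> \<forall>\<^sub>F i in sequentially. tracks e d (w j) i"
  proof (rule iterated_shadowing_limit[OF \<rho>(1) N])
    show "dist ((f ^^ i) (V (Suc k) j)) ((f ^^ i) (V k j)) \<le> \<rho> / 2 ^ Suc k" if "i < N (Suc k)" "j < n" for k i j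
      using R[of k] that unfolding R_def V_def N_def \<epsilon>_def by blast
    show "tracks e (\<rho> / 2 ^ Suc k) (V (Suc k) j) i" if "N (Suc k) \<le> i" "j < n" for k i j
      using R[of k] that unfolding R_def V_def N_def \<epsilon>_def by blast
  qed blast
  have "w j \<in> Vs f C E" if "j < n" for j
    using w(2) that Vs_iff_eventually_tracks[OF E e(1)] by blast
  moreover have "dist (w j) (z j) \<le> 2 * \<rho>" if j: "j < n" for j
  proof -
    have "N 1 > 0" using N by (metis gr0I less_nat_zero_code strict_mono_less zero_less_one)
    then have "dist (w j) (V 0 j) \<le> \<rho>" using w(1)[of 0 0 j] j by simp
    moreover have "V 0 = v0" using P[of 0] unfolding P_def V_def by simp
    moreover have "dist (v0 j) (z j) \<le> \<rho>" using v0(4)[rule_format, OF j v0(1)] by (simp add: \<epsilon>_def)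
    ultimately show ?thesis using dist_triangle[of "w j" "z j" "v0 j"] by simp
  qed
  moreover have "S_set f n x r \<in> F" if x: "x \<in> topspace (prod_top n)" "\<forall>j<n. x j = w j" for x
  proof -
    have "x \<in> U k" for k
    proof -
      have "\<rho> / 2 ^ k \<le> \<rho>" using \<rho>(1) by (simp add: field_simps)
      then have "dist ((f ^^ i) (x j)) ((f ^^ i) (V k j)) \<le> \<rho>" if "i < N (Suc k)" "j < n" for i j
        using w(1)[OF that] x(2) that by simp
      then show ?thesis using R[of k] x(1) unfolding R_def V_def N_def by blast
    qed
    then show ?thesis using S_eq by blast
  qed
  ultimately show ?thesis by blast
qed

text \<open>The target \<open>e\<close> tracks its own class at every scale, so a tuple asymptotic
  to it lies in \<open>Vs f C E\<close> after a single splice.\<close>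

lemma asymptotic_tuple_near:
  assumes shadowing: "s_limit_shadowing f" and E: "E \<in> classes_C f C" and e: "e \<in> E"
    and z: "\<forall>j<n. z (j::nat) \<in> Vs f C E" and "\<epsilon> > 0"
  shows "\<exists>w. \<forall>j<n. w j \<in> Vs f C E \<and> dist (w j) (z j) \<le> \<epsilon>
      \<and> (\<lambda>i. dist ((f ^^ i) (w j)) ((f ^^ i) e)) \<longlonglongrightarrow> 0"
proof -
  have eC: "e \<in> C" using classes_C_D(1)[OF E] e by blast
  obtain d where d: "d > 0" "\<forall>N0 (z :: nat \<Rightarrow> 'a) b.
      (\<forall>j<n. \<forall>\<^sub>F i in sequentially. tracks e d (z j) i) \<longrightarrow>
      (\<forall>j<n. \<forall>\<^sub>F i in sequentially. tracks e d (b j) i) \<longrightarrow>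
      (\<exists>w N. N > N0 \<and> (\<forall>j<n. (\<forall>i<N. dist ((f ^^ i) (w j)) ((f ^^ i) (z j)) \<le> \<epsilon>)
        \<and> (\<forall>i\<ge>N. tracks e \<epsilon> (w j) i) \<and> (\<lambda>i. dist ((f ^^ i) (w j)) ((f ^^ i) (b j))) \<longlonglongrightarrow> 0))"
    using shadow_step[OF shadowing \<open>\<epsilon> > 0\<close> eC, of n] by (elim exE conjE)
  have "\<forall>j<n. \<forall>\<^sub>F i in sequentially. tracks e d (z j) i"
    using z Vs_iff_eventually_tracks[OF E e] d(1) by blast
  moreover have "\<forall>\<^sub>F i in sequentially. tracks e d e i"
    using tracks_self[OF eC d(1)] by simp
  ultimately have "\<exists>w N. N > 0 \<and> (\<forall>j<n. (\<forall>i<N. dist ((f ^^ i) (w j)) ((f ^^ i) (z j)) \<le> \<epsilon>)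
      \<and> (\<forall>i\<ge>N. tracks e \<epsilon> (w j) i) \<and> (\<lambda>i. dist ((f ^^ i) (w j)) ((f ^^ i) e)) \<longlonglongrightarrow> 0)"
    using d(2)[rule_format, of z "\<lambda>_. e" 0] by simp
  then obtain w N where w: "N > 0" "\<forall>j<n. \<forall>i<N. dist ((f ^^ i) (w j)) ((f ^^ i) (z j)) \<le> \<epsilon>"
      "\<forall>j<n. (\<lambda>i. dist ((f ^^ i) (w j)) ((f ^^ i) e)) \<longlonglongrightarrow> 0"
    by blast
  have "w j \<in> Vs f C E" if j: "j < n" for j
    unfolding Vs_iff_eventually_tracks[OF E e]
  proof (intro allI impI)
    fix d :: real assume "d > 0"
    then have d2: "d/2 > 0" by simp
    have "\<forall>\<^sub>F i in sequentially. tracks e (d/2) e i" using tracks_self[OF eC d2] by simp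
    from eventually_tracks_asymptotic[OF this w(3)[rule_format, OF j] d2]
    show "\<forall>\<^sub>F i in sequentially. tracks e d (w j) i" by simp
  qed
  moreover have "dist (w j) (z j) \<le> \<epsilon>" if "j < n" for j
    using w(1,2) that by (metis funpow_0)
  ultimately show ?thesis using w(3) by blast
qed

end

theorem theorem1p4:
  fixes f :: "'a::metric_space \<Rightarrow> 'a"
    and C D :: "'a set" and F G :: "nat set set" and n :: nat and \<delta> :: real
  assumes "compact (UNIV :: 'a set)"
    and "continuous_on UNIV f"
    and "s_limit_shadowing f"
    and "C \<in> chain_components f"
    and "D \<in> classes_C f C"
    and "furstenberg F" and "full_family F"
    and "furstenberg G" and "full_family G"
    and "\<forall>m\<ge>2. compatible F f m \<and> compatible G f m"
    and "translation_invariant F"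
    and "n \<ge> 2" and "\<delta> > 0"
    and "\<exists>a :: nat \<Rightarrow> 'a. (\<forall>i<n. a i \<in> Vs f C D) \<and> S_set f n a \<delta> \<in> F"
  shows "\<forall>E \<in> classes_C f C. \<forall>r. 0 < r \<and> r < \<delta> \<longrightarrow> generic_chaotic F G f n r (Vs f C E)"
proof (intro ballI allI impI)
  fix E r assume E: "E \<in> classes_C f C" and r: "0 < r \<and> r < \<delta>"
  interpret chain_component f C using assms(1,2,4) by unfold_locales
  obtain a where a: "\<forall>j<n. a j \<in> Vs f C D" "S_set f n a \<delta> \<in> F"
    using assms(14) by blast
  have compat: "compatible F f n" "compatible G f n" using assms(10,12) by blast+
  obtain e where e: "e \<in> E" "e \<in> C" using classes_C_D(1,2)[OF E] by blast
  let ?X = "prod_top n :: (nat \<Rightarrow> 'a) topology"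
  let ?Y = "PiE {..<n} (\<lambda>_. Vs f C E)"
  let ?S = "{x \<in> topspace ?X. S_set f n x r \<in> F}"
  \<comment> \<open>The tolerances \<open>1 / Suc m\<close> suffice for proximality and keep the
    intersection countable.\<close>
  let ?T = "\<lambda>m. {x \<in> topspace ?X. T_set f n x (1 / Suc m) \<in> G}"
  have restrict_top: "restrict w {..<n} \<in> topspace ?X" for w
    by (simp add: topspace_prod_top)
  have "residual_in (subtopology ?X ?Y) ?S"
  proof (rule residual_in_dense_gdelta[OF gdelta_in_S_set[OF compat(1)]])
    fix U z assume U: "openin ?X U" "z \<in> U" and z: "z \<in> ?Y"
    obtain h where h: "h > 0"
      "\<And>w. w \<in> topspace ?X \<Longrightarrow> (\<And>j. j < n \<Longrightarrow> dist (w j) (z j) < h) \<Longrightarrow> w \<in> U"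
      using openin_prod_top_contains_box[OF U] by blast
    have "0 < min (h / 2) ((\<delta> - r) / 2)" using h(1) r by simp
    \<comment> \<open>The displacement \<open>2 * \<rho>\<close> has to fit into the box around
      \<open>z\<close>, and the loss of separation into the gap between \<open>r\<close> and
      \<open>\<delta>\<close>.\<close>
    then obtain \<rho> where "0 < \<rho>" "\<rho> < min (h / 2) ((\<delta> - r) / 2)" using dense by blast
    then have "\<rho> < h / 2" "\<rho> < (\<delta> - r) / 2" by simp_all
    then have "\<rho> * 2 < h" "\<rho> * 2 < \<delta> - r" by (simp_all only: less_divide_eq_numeral1)
    then have \<rho>': "r + 2 * \<rho> < \<delta>" "2 * \<rho> < h" by linarith+
    from gdelta_in_descending[THEN iffD1, OF gdelta_in_S_set[OF compat(1), of r]]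
    obtain W where "\<forall>k. openin ?X (W k)" "\<forall>k. W (Suc k) \<subseteq> W k" "\<Inter>(range W) = ?S"
      by (elim exE conjE)
    then have W: "openin ?X (W k)" "(\<Inter>k. W k) = ?S" for k by simp_all
    obtain w where w: "\<forall>j<n. w j \<in> Vs f C E \<and> dist (w j) (z j) \<le> 2 * \<rho>"
        "\<forall>x\<in>topspace ?X. (\<forall>j<n. x j = w j) \<longrightarrow> S_set f n x r \<in> F"
    proof -
      have "\<forall>j<n. z j \<in> Vs f C E" using z by (auto simp: PiE_iff)
      from separated_tuple_near[OF assms(3,5) E assms(6,7,11) a this W \<open>0 < \<rho>\<close> \<rho>'(1)] show ?thesis
        by (elim exE conjE) (rule that)
    qed
    \<comment> \<open>Points of \<open>?X\<close> are extensional on \<open>{..<n}\<close>, whereas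
      \<open>w\<close> is arbitrary from \<open>n\<close> on.\<close>
    let ?w = "restrict w {..<n}"
    have "?w \<in> U" using h(2)[OF restrict_top] w(1) \<rho>'(2) by force
    moreover have "?w \<in> ?Y" using w(1) by simp
    moreover have "?w \<in> ?S" using w(2) restrict_top by simp
    ultimately show "\<exists>w. w \<in> U \<and> w \<in> ?Y \<and> w \<in> ?S" by blast
  qed
  moreover have "residual_in (subtopology ?X ?Y) (?T m)" for m
  proof (rule residual_in_dense_gdelta[OF gdelta_in_T_set[OF compat(2)]])
    fix U z assume U: "openin ?X U" "z \<in> U" and z: "z \<in> ?Y"
    obtain h where h: "h > 0"
      "\<And>w. w \<in> topspace ?X \<Longrightarrow> (\<And>j. j < n \<Longrightarrow> dist (w j) (z j) < h) \<Longrightarrow> w \<in> U"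
      using openin_prod_top_contains_box[OF U] by blast
    have "h / 2 > 0" using h(1) by simp
    have "\<forall>j<n. z j \<in> Vs f C E" using z by (auto simp: PiE_iff)
    from asymptotic_tuple_near[OF assms(3) E e(1) this \<open>h / 2 > 0\<close>]
    obtain w where w: "\<forall>j<n. w j \<in> Vs f C E \<and> dist (w j) (z j) \<le> h / 2
        \<and> (\<lambda>i. dist ((f ^^ i) (w j)) ((f ^^ i) e)) \<longlonglongrightarrow> 0"
      by (elim exE)
    let ?w = "restrict w {..<n}"
    have "?w \<in> U" using h w(1) by (intro h(2)[OF restrict_top]) force
    moreover have "?w \<in> ?Y" using w(1) by simp
    moreover have "T_set f n ?w (1 / Suc m) \<in> G"
      using w by (intro T_set_asymptotic[OF assms(8,9)]) auto
    ultimately show "\<exists>w. w \<in> U \<and> w \<in> ?Y \<and> w \<in> ?T m" using restrict_top by blast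
  qed
  ultimately have "residual_in (subtopology ?X ?Y) (?S \<inter> (\<Inter>m. ?T m))"
    by (intro residual_in_Int residual_in_INT)
  then obtain W :: "nat \<Rightarrow> _" where W: "\<And>i. openin (subtopology ?X ?Y) (W i)"
      "\<And>i. subtopology ?X ?Y closure_of (W i) = topspace (subtopology ?X ?Y)"
      "(\<Inter>i. W i) \<subseteq> ?S \<inter> (\<Inter>m. ?T m)"
    unfolding residual_in_def by blast
  have "scrambled F G f n r x" if x: "x \<in> ?S" "\<And>m. x \<in> ?T m" for x
    unfolding scrambled_def
  proof (intro conjI allI impI)
    show "S_set f n x r \<in> F" using x(1) by simp
    fix h :: real assume "h > 0"
    then obtain m where m: "1 / Suc m < h" using nat_approx_posE by blast
    have "T_set f n x (1 / Suc m) \<in> G" using x(2)[of m] by simp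
    moreover have "T_set f n x (1 / Suc m) \<subseteq> T_set f n x h"
      unfolding T_set_def using m by (auto intro: less_trans)
    ultimately show "T_set f n x h \<in> G" by (rule furstenberg_mono[OF assms(8)])
  qed
  then have "?S \<inter> (\<Inter>m. ?T m) \<subseteq> {x. scrambled F G f n r x}" by auto
  with W(3) have "(\<Inter>i. W i) \<subseteq> {x. scrambled F G f n r x}" by (rule order_trans)
  \<comment> \<open>\<open>?S\<close> and \<open>?T\<close> range over all of \<open>?X\<close>;
    confinement to \<open>?Y\<close> comes from the open sets of the subspace.\<close>
  moreover have "W 0 \<subseteq> ?Y" using openin_subset[OF W(1)[of 0]] by simp
  ultimately have "(\<Inter>i. W i) \<subseteq> {x \<in> ?Y. scrambled F G f n r x}" by auto
  then have "residual_in (subtopology ?X ?Y) {x \<in> ?Y. scrambled F G f n r x}"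
    unfolding residual_in_def using W(1,2) by (intro exI[of _ W]) simp
  moreover have "e \<in> Vs f C E"
    unfolding Vs_iff_eventually_tracks[OF E e(1)] using tracks_self[OF e(2)]
    by (intro allI impI always_eventually)
  then have "Vs f C E \<noteq> {}" by blast
  ultimately show "generic_chaotic F G f n r (Vs f C E)"
    unfolding generic_chaotic_def by (intro conjI)
qed

end
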